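(* The following assertions hold. (i) The group of characters $\Omega(\mathcal{O}_{\mathbb{K}})$ is an orthonormal basis of $L^{2}(\mathcal{O}_{\mathbb{K}})\otimes\mathbb{C}$. (ii) Set $$\omega_{\wp,\boldsymbol{a},l}(x):=\chi_{\mathbb{K}}\left(\wp^{-l}\boldsymbol{a}\,\varrho_{\mathbb{K}}(x)\right),\quad x\in[0,1],\ l\in\mathbb{N}\smallsetminus\{0\},\ \boldsymbol{a}\in G_{l}(\mathcal{O}_{\mathbb{K}}).$$ Then the set of functions $\{\omega_{\wp,\boldsymbol{a},l}\}_{\boldsymbol{a},l}\cup\{1_{[0,1]}\}$ is an orthonormal basis of $L^{2}([0,1])\otimes\mathbb{C}$.
   Context: Let $p$ be a prime and let $\mathbb{K}$ be $\mathbb{Q}_p$ (with $\wp=p$) or $\mathbb{F}_p((T))$ (with $\wp=T$), with ring of integers $\mathcal{O}_{\mathbb{K}}$ and Haar measure normalized by $\int_{\mathcal{O}_{\mathbb{K}}}dx=1$. $L^2(\mathcal{O}_{\mathbb{K}})\otimes\mathbb{C}$ is the space of complex-valued square-integrable functions on $\mathcal{O}_{\mathbb{K}}$ for this measure, with $\langle f,g\rangle=\int_{\mathcal{O}_{\mathbb{K}}}f\bar g\,dx$. $L^2([0,1])\otimes\mathbb{C}$ is the complex $L^2$ space for Lebesgue measure. $G_l(\mathcal{O}_{\mathbb{K}})=\mathcal{O}_{\mathbb{K}}/\wp^l\mathcal{O}_{\mathbb{K}}$, identified with the representatives $a_0+\dots+a_{l-1}\wp^{l-1}$, $a_j\in\{0,\dots,p-1\}$.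 An orthonormal basis means a Hilbert (complete orthonormal) basis. $\chi_{\mathbb{K}}$ is a standard additive character of $\mathbb{K}$: a nontrivial continuous homomorphism from $(\mathbb{K},+)$ to the complex unit circle which is identically $1$ on $\mathcal{O}_{\mathbb{K}}$. Concretely, $\chi_{\mathbb{K}}(x)=\exp(2\pi i\{x\}_p)$ for $\mathbb{K}=\mathbb{Q}_p$, where $\{x\}_p=\sum_{k=r}^{-1}a_kp^k$ is the fractional part of $x=\sum_{k\ge r}a_kp^k$ ($\{x\}_p=0$ if $r\geq 0$), and $\chi_{\mathbb{K}}(x)=\exp\big(\tfrac{2\pi i}{p}a_{-1}\big)$ for $x=\sum_k a_kT^k\in\mathbb{F}_p((T))$. $\Omega(\mathcal{O}_{\mathbb{K}})$ is the group of additive characters of $\mathcal{O}_{\mathbb{K}}$, that is, the set of functions $x\mapsto\chi_{\mathbb{K}}(\wp^{-l}\boldsymbol{a}x)$ on $\mathcal{O}_{\mathbb{K}}$ with $l\in\mathbb{N}\smallsetminus\{0\}$, $\boldsymbol{a}\in G_l(\mathcal{O}_{\mathbb{K}})$, together with the trivial character (different pairs $(l,\boldsymbol{a})$ may give the same function; each is counted once, and likewise for the $\omega_{\wp,\boldsymbol{a},l}$). The map $\varrho_{\mathbb{K}}:[0,1]\to\mathcal{O}_{\mathbb{K}}$ is $\varrho_{\mathbb{K}}\big(\sum_{i\ge0} x_ip^{-i-1}\big)=\sum_{i\ge0} x_i\wp^i$, where $x=\sum_i x_ip^{-i-1}$, $x_i\in\{0,\dots,p-1\}$, is the base-$p$ expansion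 given by the greedy algorithm (finite expansions are used whenever possible; for $x=1$ all digits are $p-1$). *)

theory Defs
  imports
    "HOL-Analysis.Analysis"
    "HOL-Computational_Algebra.Formal_Laurent_Series"
    "HOL-Computational_Algebra.Fraction_Field"
    "Berlekamp_Zassenhaus.Finite_Field"
begin

section \<open>The \<open>p\<close>-adic integers\<close>

text \<open>
  The prime is \<open>CARD('p)\<close> for a type \<open>'p\<close> of class \<open>prime_card\<close>, and the field with
  \<open>CARD('p)\<close> elements is \<open>'p mod_ring\<close>.  The ring of \<open>p\<close>-adic integers is the inverse limit of
  the rings of integers modulo \<open>p^n\<close>: the \<open>n\<close>-th component of an element is its residue
  modulo \<open>p^n\<close>.
\<close>

typedef (overloaded) 'p padic_int =
  "{f :: nat \<Rightarrow> int. \<forall>n. f n \<in> {0..<int CARD('p::prime_card) ^ n}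
      \<and> f (Suc n) mod int CARD('p) ^ n = f n}"
  morphisms padic_residue Abs_padic_int
proof -
  have "0 < int CARD('p)" by simp
  then show ?thesis by (intro exI[of _ "\<lambda>_. 0"]) simp
qed

setup_lifting type_definition_padic_int

lemma mod_mod_power_Suc: "(a mod q ^ Suc n) mod q ^ n = a mod (q ^ n :: int)"
  by (rule mod_mod_cancel) simp

lemma mod_power_mem: "a mod int CARD('p::prime_card) ^ n \<in> {0..<int CARD('p) ^ n}"
  by simp

instantiation padic_int :: (prime_card) comm_ring_1
begin

lift_definition zero_padic_int :: "'a padic_int" is "\<lambda>n. 0 mod int CARD('a) ^ n"
  by (auto simp: mod_mod_power_Suc simp del: power_Suc)

lift_definition one_padic_int :: "'a padic_int" is "\<lambda>n. 1 mod int CARD('a) ^ n"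
  using mod_mod_power_Suc[of 1 "int CARD('a)"] by (auto simp del: power_Suc)

lift_definition plus_padic_int :: "'a padic_int \<Rightarrow> 'a padic_int \<Rightarrow> 'a padic_int"
  is "\<lambda>f g n. (f n + g n) mod int CARD('a) ^ n"
proof -
  fix f g :: "nat \<Rightarrow> int" and n
  assume "\<And>n. f n \<in> {0..<int CARD('a) ^ n} \<and> f (Suc n) mod int CARD('a) ^ n = f n"
    and "\<And>n. g n \<in> {0..<int CARD('a) ^ n} \<and> g (Suc n) mod int CARD('a) ^ n = g n"
  then show "(f n + g n) mod int CARD('a) ^ n \<in> {0..<int CARD('a) ^ n} \<and>
      (f (Suc n) + g (Suc n)) mod int CARD('a) ^ Suc n mod int CARD('a) ^ n
        = (f n + g n) mod int CARD('a) ^ n"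
    by (metis mod_mod_power_Suc mod_power_mem mod_add_eq)
qed

lift_definition uminus_padic_int :: "'a padic_int \<Rightarrow> 'a padic_int"
  is "\<lambda>f n. (- f n) mod int CARD('a) ^ n"
proof -
  fix f :: "nat \<Rightarrow> int" and n
  assume "\<And>n. f n \<in> {0..<int CARD('a) ^ n} \<and> f (Suc n) mod int CARD('a) ^ n = f n"
  then show "(- f n) mod int CARD('a) ^ n \<in> {0..<int CARD('a) ^ n} \<and>
      (- f (Suc n)) mod int CARD('a) ^ Suc n mod int CARD('a) ^ n = (- f n) mod int CARD('a) ^ n"
    by (metis mod_mod_power_Suc mod_power_mem mod_minus_eq)
qed

lift_definition minus_padic_int :: "'a padic_int \<Rightarrow> 'a padic_int \<Rightarrow> 'a padic_int"
  is "\<lambda>f g n. (f n - g n) mod int CARD('a) ^ n"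
proof -
  fix f g :: "nat \<Rightarrow> int" and n
  assume "\<And>n. f n \<in> {0..<int CARD('a) ^ n} \<and> f (Suc n) mod int CARD('a) ^ n = f n"
    and "\<And>n. g n \<in> {0..<int CARD('a) ^ n} \<and> g (Suc n) mod int CARD('a) ^ n = g n"
  then show "(f n - g n) mod int CARD('a) ^ n \<in> {0..<int CARD('a) ^ n} \<and>
      (f (Suc n) - g (Suc n)) mod int CARD('a) ^ Suc n mod int CARD('a) ^ n
        = (f n - g n) mod int CARD('a) ^ n"
    by (metis mod_mod_power_Suc mod_power_mem mod_diff_eq)
qed

lift_definition times_padic_int :: "'a padic_int \<Rightarrow> 'a padic_int \<Rightarrow> 'a padic_int"
  is "\<lambda>f g n. (f n * g n) mod int CARD('a) ^ n"
proof -
  fix f g :: "nat \<Rightarrow> int" and n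
  assume "\<And>n. f n \<in> {0..<int CARD('a) ^ n} \<and> f (Suc n) mod int CARD('a) ^ n = f n"
    and "\<And>n. g n \<in> {0..<int CARD('a) ^ n} \<and> g (Suc n) mod int CARD('a) ^ n = g n"
  then show "(f n * g n) mod int CARD('a) ^ n \<in> {0..<int CARD('a) ^ n} \<and>
      (f (Suc n) * g (Suc n)) mod int CARD('a) ^ Suc n mod int CARD('a) ^ n
        = (f n * g n) mod int CARD('a) ^ n"
    by (metis mod_mod_power_Suc mod_power_mem mod_mult_eq)
qed

instance
proof
  fix a b c :: "'a padic_int"
  show "a * b * c = a * (b * c)" by transfer (simp add: mod_simps mult.assoc)
  show "a * b = b * a" by transfer (simp add: mult.commute)
  show "1 * a = a" by transfer (auto simp: mod_simps)
  show "a + b + c = a + (b + c)" by transfer (simp add: mod_simps add.assoc)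
  show "a + b = b + a" by transfer (simp add: add.commute)
  show "0 + a = a" by transfer auto
  show "- a + a = 0" by transfer (simp add: mod_simps)
  show "a - b = a + - b" by transfer (simp add: mod_simps)
  show "(a + b) * c = a * c + b * c" by transfer (simp add: mod_simps distrib_right)
  have "1 < int CARD('a)"
    using prime_gt_1_nat[OF prime_card[where 'a='a]] by simp
  then show "(0::'a padic_int) \<noteq> 1"
    by transfer (auto simp: fun_eq_iff intro!: exI[of _ 1])
qed

end

lemma padic_residue_zero [simp]: "padic_residue 0 n = 0"
  by transfer simp

lemma padic_residue_add:
  fixes x y :: "'p::prime_card padic_int"
  shows "padic_residue (x + y) n = (padic_residue x n + padic_residue y n) mod int CARD('p) ^ n"
  by transfer simp

lemma padic_residue_mult:
  fixes x y :: "'p::prime_card padic_int"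
  shows "padic_residue (x * y) n = (padic_residue x n * padic_residue y n) mod int CARD('p) ^ n"
  by transfer simp

lemma padic_residue_range:
  fixes x :: "'p::prime_card padic_int"
  shows "0 \<le> padic_residue x n" "padic_residue x n < int CARD('p) ^ n"
  by (transfer; simp)+

lemma padic_residue_mod:
  fixes x :: "'p::prime_card padic_int"
  assumes "m \<le> n"
  shows "padic_residue x n mod int CARD('p) ^ m = padic_residue x m"
  using assms
proof (induction n rule: dec_induct)
  case base
  show ?case using padic_residue_range[of x m] by simp
next
  case (step n)
  have "padic_residue x (Suc n) mod int CARD('p) ^ n = padic_residue x n"
    by transfer simp
  moreover have "int CARD('p) ^ m dvd int CARD('p) ^ n"
    using step.hyps by (intro le_imp_power_dvd) simp
  ultimately show ?case using step.IH by (metis mod_mod_cancel)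
qed

lemma padic_residue_0 [simp]:
  fixes x :: "'p::prime_card padic_int"
  shows "padic_residue x 0 = 0"
  using padic_residue_range[of x 0] by simp

lemma padic_residue_dvd_iff:
  fixes x :: "'p::prime_card padic_int"
  assumes "m \<le> n"
  shows "int CARD('p) ^ m dvd padic_residue x n \<longleftrightarrow> padic_residue x m = 0"
  using padic_residue_mod[OF assms, of x] by (auto simp: dvd_eq_mod_eq_0)

lemma padic_int_eq_0_iff:
  fixes x :: "'p::prime_card padic_int"
  shows "x = 0 \<longleftrightarrow> (\<forall>n. padic_residue x n = 0)"
  by transfer auto

text \<open>The valuation of a nonzero \<open>x\<close> is the largest \<open>n\<close> with \<open>x\<close> divisible by \<open>p^n\<close>.\<close>

definition padic_val :: "'p::prime_card padic_int \<Rightarrow> nat" where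
  "padic_val x = (LEAST n. padic_residue x (Suc n) \<noteq> 0)"

lemma padic_val_residue_iff:
  fixes x :: "'p::prime_card padic_int"
  assumes "x \<noteq> 0"
  shows "padic_residue x n = 0 \<longleftrightarrow> n \<le> padic_val x"
proof -
  obtain k where "padic_residue x k \<noteq> 0" using assms padic_int_eq_0_iff by blast
  moreover from this obtain j where "k = Suc j" by (cases k) auto
  ultimately have ex: "padic_residue x (Suc j) \<noteq> 0" by simp
  have up: "padic_residue x m = 0" if "m \<le> n" "padic_residue x n = 0" for m n
    using padic_residue_mod[OF that(1), of x] that(2) by simp
  have nz: "padic_residue x (Suc (padic_val x)) \<noteq> 0"
    unfolding padic_val_def by (rule LeastI[of _ j]) (rule ex)
  show ?thesis
  proof
    assume "padic_residue x n = 0"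
    then show "n \<le> padic_val x" using up[of "Suc (padic_val x)" n] nz by force
  next
    assume n: "n \<le> padic_val x"
    show "padic_residue x n = 0"
    proof (cases n)
      case (Suc i)
      then have "i < (LEAST n. padic_residue x (Suc n) \<noteq> 0)"
        using n by (simp add: padic_val_def)
      from not_less_Least[OF this] show ?thesis using Suc by simp
    qed simp
  qed
qed

lemma padic_int_mult_aux:
  fixes x y :: "'p::prime_card padic_int"
  assumes "x \<noteq> 0" "y \<noteq> 0"
  defines "v \<equiv> padic_val x" and "w \<equiv> padic_val y"
  shows "padic_residue (x * y) (v + w) = 0" "padic_residue (x * y) (Suc (v + w)) \<noteq> 0"
proof -
  let ?p = "int CARD('p)"
  have p: "prime ?p" using prime_card[where 'a='p] by simp
  have "padic_residue x v = 0" "padic_residue y w = 0"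
    using assms padic_val_residue_iff by blast+
  then have "?p ^ v dvd padic_residue x (v + w)" "?p ^ w dvd padic_residue y (v + w)"
    by (simp_all add: padic_residue_dvd_iff)
  then have "?p ^ (v + w) dvd padic_residue x (v + w) * padic_residue y (v + w)"
    by (simp add: power_add mult_dvd_mono)
  then show "padic_residue (x * y) (v + w) = 0" by (simp add: padic_residue_mult)
  show "padic_residue (x * y) (Suc (v + w)) \<noteq> 0"
  proof
    let ?N = "Suc (v + w)"
    assume "padic_residue (x * y) ?N = 0"
    then have d: "?p ^ ?N dvd padic_residue x ?N * padic_residue y ?N"
      by (simp add: padic_residue_mult dvd_eq_mod_eq_0 del: power_Suc)
    have "?p ^ v dvd padic_residue x ?N" "?p ^ w dvd padic_residue y ?N"
      using \<open>padic_residue x v = 0\<close> \<open>padic_residue y w = 0\<close>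
      by (simp_all add: padic_residue_dvd_iff)
    then obtain a b where ab: "padic_residue x ?N = ?p ^ v * a" "padic_residue y ?N = ?p ^ w * b"
      by (auto elim!: dvdE)
    with d have "?p ^ (v + w) * ?p dvd ?p ^ (v + w) * (a * b)"
      by (simp add: power_add mult_ac)
    then have "?p dvd a * b" by (simp add: dvd_mult_cancel_left)
    then have "?p dvd a \<or> ?p dvd b" using p by (simp add: prime_dvd_mult_iff)
    then have "?p ^ Suc v dvd padic_residue x ?N \<or> ?p ^ Suc w dvd padic_residue y ?N"
      unfolding ab by (auto simp: mult.commute[of ?p] intro: mult_dvd_mono)
    then have "padic_residue x (Suc v) = 0 \<or> padic_residue y (Suc w) = 0"
      by (metis padic_residue_dvd_iff Suc_le_mono le_add1 le_add2)
    then show False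
      using padic_val_residue_iff[OF assms(1), of "Suc v"]
        padic_val_residue_iff[OF assms(2), of "Suc w"] by (auto simp: v_def w_def)
  qed
qed

instance padic_int :: (prime_card) idom
proof
  fix x y :: "'a padic_int"
  assume "x \<noteq> 0" "y \<noteq> 0"
  from padic_int_mult_aux(2)[OF this] show "x * y \<noteq> 0" by auto
qed

lemma padic_val_mult:
  fixes x y :: "'p::prime_card padic_int"
  assumes "x \<noteq> 0" "y \<noteq> 0"
  shows "padic_val (x * y) = padic_val x + padic_val y"
  using padic_int_mult_aux[OF assms] assms padic_val_residue_iff[of "x * y"]
  by (metis le_antisym mult_eq_0_iff not_less_eq_eq)

lemma padic_val_add:
  fixes x y :: "'p::prime_card padic_int"
  assumes "x \<noteq> 0" "y \<noteq> 0" "x + y \<noteq> 0"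
  shows "min (padic_val x) (padic_val y) \<le> padic_val (x + y)"
proof -
  let ?m = "min (padic_val x) (padic_val y)"
  have "padic_residue x ?m = 0" "padic_residue y ?m = 0"
    using assms by (simp_all add: padic_val_residue_iff)
  then have "padic_residue (x + y) ?m = 0" by (simp add: padic_residue_add)
  then show ?thesis using padic_val_residue_iff[OF assms(3)] by simp
qed

section \<open>The field of \<open>p\<close>-adic numbers\<close>

text \<open>
  An absolute value on an integral domain extends to the fraction field and makes it a metric
  space.  The field of \<open>p\<close>-adic numbers is obtained in this way from the \<open>p\<close>-adic integers.
\<close>

class absval_idom = idom +
  fixes absval :: "'a \<Rightarrow> real"
  assumes absval_nonneg: "0 \<le> absval x"
    and absval_eq_0_iff [simp]: "absval x = 0 \<longleftrightarrow> x = 0"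
    and absval_mult: "absval (x * y) = absval x * absval y"
    and absval_triangle: "absval (x + y) \<le> absval x + absval y"
begin

lemma absval_minus: "absval (- x) = absval x"
proof -
  have "absval (- x) * absval (- x) = absval x * absval x"
    by (simp flip: absval_mult)
  then show ?thesis
    using absval_nonneg[of x] absval_nonneg[of "- x"] by (metis abs_of_nonneg abs_mult_self_eq real_sqrt_abs2)
qed

end

instantiation padic_int :: (prime_card) absval_idom
begin

definition absval_padic_int :: "'a padic_int \<Rightarrow> real" where
  "absval x = (if x = 0 then 0 else 1 / real CARD('a) ^ padic_val x)"

instance
proof
  fix x y :: "'a padic_int"
  have p: "1 < real CARD('a)"
    using prime_gt_1_nat[OF prime_card[where 'a='a]] by simp
  show nn: "0 \<le> absval x" for x :: "'a padic_int" by (simp add: absval_padic_int_def)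
  show "absval x = 0 \<longleftrightarrow> x = 0" by (simp add: absval_padic_int_def)
  show "absval (x * y) = absval x * absval y"
    by (auto simp: absval_padic_int_def padic_val_mult power_add)
  show "absval (x + y) \<le> absval x + absval y"
  proof (cases "x = 0 \<or> y = 0 \<or> x + y = 0")
    case True
    then show ?thesis using nn[of x] nn[of y] by (auto simp: absval_padic_int_def)
  next
    case False
    have dec: "1 / real CARD('a) ^ n \<le> 1 / real CARD('a) ^ m" if "m \<le> n" for m n
      using p that by (intro divide_left_mono power_increasing) auto
    from False padic_val_add[of x y] have
      "padic_val x \<le> padic_val (x + y) \<or> padic_val y \<le> padic_val (x + y)" by auto
    then have "absval (x + y) \<le> absval x \<or> absval (x + y) \<le> absval y"
      using False by (auto simp: absval_padic_int_def intro: dec)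
    then show ?thesis using nn[of x] nn[of y] by linarith
  qed
qed

end

definition absval_fract :: "'a::absval_idom fract \<Rightarrow> real" where
  "absval_fract x = (THE r. \<exists>a b. b \<noteq> 0 \<and> x = Fract a b \<and> r = absval a / absval b)"

lemma absval_fract_Fract:
  assumes "b \<noteq> 0"
  shows "absval_fract (Fract a b) = absval a / absval b"
  unfolding absval_fract_def
proof (rule the_equality)
  show "\<exists>a' b'. b' \<noteq> 0 \<and> Fract a b = Fract a' b' \<and> absval a / absval b = absval a' / absval b'"
    using assms by blast
next
  fix r
  assume "\<exists>a' b'. b' \<noteq> 0 \<and> Fract a b = Fract a' b' \<and> r = absval a' / absval b'"
  then obtain a' b' where ab: "b' \<noteq> 0" "a * b' = a' * b" "r = absval a' / absval b'"
    using assms by (auto simp: eq_fract)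
  from ab(2) have "absval a * absval b' = absval a' * absval b"
    by (simp flip: absval_mult)
  then show "r = absval a / absval b"
    using ab assms by (simp add: frac_eq_eq)
qed

lemma absval_fract_eq_0_iff: "absval_fract x = 0 \<longleftrightarrow> x = 0"
  by (cases x) (simp add: absval_fract_Fract eq_fract Zero_fract_def)

lemma absval_fract_minus: "absval_fract (- x) = absval_fract x"
  by (cases x) (simp add: absval_fract_Fract absval_minus)

lemma absval_fract_triangle: "absval_fract (x + y) \<le> absval_fract x + absval_fract y"
proof (cases x, cases y)
  fix a b c d :: 'a
  assume xy: "x = Fract a b" "b \<noteq> 0" "y = Fract c d" "d \<noteq> 0"
  then have pos: "0 < absval b" "0 < absval d"
    using absval_nonneg by (simp_all add: less_le eq_commute[of 0])
  have "absval_fract (x + y) = absval (a * d + c * b) / (absval b * absval d)"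
    using xy by (simp add: absval_fract_Fract absval_mult)
  also have "\<dots> \<le> (absval a * absval d + absval c * absval b) / (absval b * absval d)"
    using absval_triangle[of "a * d" "c * b"] pos
    by (intro divide_right_mono) (simp_all add: absval_mult)
  also have "\<dots> = absval_fract x + absval_fract y"
    using xy pos by (simp add: absval_fract_Fract field_simps)
  finally show ?thesis .
qed

instantiation fract :: (absval_idom) metric_space
begin

definition dist_fract :: "'a fract \<Rightarrow> 'a fract \<Rightarrow> real" where
  "dist x y = absval_fract (x - y)"

definition uniformity_fract :: "('a fract \<times> 'a fract) filter" where
  "uniformity_fract = (INF e\<in>{0 <..}. principal {(x, y). dist x y < e})"

definition open_fract :: "'a fract set \<Rightarrow> bool" where
  "open_fract U \<longleftrightarrow> (\<forall>x\<in>U. eventually (\<lambda>(x', y). x' = x \<longrightarrow> y \<in> U) uniformity)"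

instance
proof
  fix x y z :: "'a fract"
  show "dist x y = 0 \<longleftrightarrow> x = y" by (simp add: dist_fract_def absval_fract_eq_0_iff)
  have "dist x y \<le> absval_fract (x - z) + absval_fract (z - y)"
    using absval_fract_triangle[of "x - z" "z - y"] by (simp add: dist_fract_def)
  also have "absval_fract (z - y) = absval_fract (y - z)"
    using absval_fract_minus[of "y - z"] by simp
  finally show "dist x y \<le> dist x z + dist y z" by (simp add: dist_fract_def)
qed (simp_all add: uniformity_fract_def open_fract_def)

end

type_synonym 'p padic = "'p padic_int fract"

section \<open>Additive characters\<close>

text \<open>
  Digits of \<open>x = (\<Sum>k\<ge>r. a k * p^k)\<close>, extended by \<open>0\<close> below \<open>r\<close>.
\<close>

definition padic_digits :: "'p::prime_card padic \<Rightarrow> int \<Rightarrow> nat" where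
  "padic_digits x = (THE a. (\<forall>k. a k < CARD('p)) \<and>
     (\<exists>r. (\<forall>k<r. a k = 0) \<and>
        (\<lambda>i. of_nat (a (r + int i)) * of_nat CARD('p) powi (r + int i)) sums x))"

definition padic_frac :: "'p::prime_card padic \<Rightarrow> real" where
  "padic_frac x = (\<Sum>k | k < 0 \<and> padic_digits x k \<noteq> 0.
     real (padic_digits x k) * real CARD('p) powi k)"

definition padic_char :: "'p::prime_card padic \<Rightarrow> complex" where
  "padic_char x = exp (2 * of_real pi * \<i> * of_real (padic_frac x))"

definition laurent_char :: "'p::prime_card mod_ring fls \<Rightarrow> complex" where
  "laurent_char x =
     exp (2 * of_real pi * \<i> / of_nat CARD('p) * of_int (to_int_mod_ring (fls_nth x (- 1))))"

section \<open>Integers, Haar measure and Hilbert bases\<close>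

text \<open>
  The following notions are used for \<open>'p padic\<close> with uniformizer \<open>of_nat CARD('p)\<close> and for
  \<open>'p mod_ring fls\<close> with uniformizer \<open>fls_X\<close>.  In both cases the metric comes from an absolute
  value (for Laurent series: \<open>2\<close> to the power \<open>- fls_subdegree\<close>), whose closed unit ball is
  the ring of integers.  The digit \<open>j < p\<close> is \<open>of_nat j\<close> in either field.
\<close>

definition integers :: "'k::{field,metric_space} set" where
  "integers = cball 0 1"

definition normalized_haar :: "'k::{field,metric_space} measure \<Rightarrow> bool" where
  "normalized_haar \<mu> \<longleftrightarrow> sets \<mu> = sets borel \<and>
     (\<forall>a. \<forall>A\<in>sets borel. emeasure \<mu> ((+) a ` A) = emeasure \<mu> A) \<and>
     emeasure \<mu> integers = 1"

definition L2 :: "'a measure \<Rightarrow> ('a \<Rightarrow> complex) set" where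
  "L2 M = {f \<in> borel_measurable M. integrable M (\<lambda>x. (cmod (f x))\<^sup>2)}"

definition L2_inner :: "'a measure \<Rightarrow> ('a \<Rightarrow> complex) \<Rightarrow> ('a \<Rightarrow> complex) \<Rightarrow> complex" where
  "L2_inner M f g = (LINT x|M. f x * cnj (g x))"

definition L2_norm :: "'a measure \<Rightarrow> ('a \<Rightarrow> complex) \<Rightarrow> real" where
  "L2_norm M f = sqrt (LINT x|M. (cmod (f x))\<^sup>2)"

text \<open>
  Elements of the Hilbert space are represented by functions.  Orthogonality of distinct members
  of \<open>B\<close> forces distinct members to represent distinct classes modulo null functions.
\<close>

definition orthonormal_basis :: "'a measure \<Rightarrow> ('a \<Rightarrow> complex) set \<Rightarrow> bool" where
  "orthonormal_basis M B \<longleftrightarrow> B \<subseteq> L2 M \<and>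
     (\<forall>f\<in>B. \<forall>g\<in>B. L2_inner M f g = (if f = g then 1 else 0)) \<and>
     (\<forall>f\<in>L2 M. \<forall>\<epsilon>>0. \<exists>F c. finite F \<and> F \<subseteq> B \<and>
        L2_norm M (\<lambda>x. f x - (\<Sum>b\<in>F. c b * b x)) < \<epsilon>)"

section \<open>Character groups and their transport to the unit interval\<close>

text \<open>Representatives of the integers modulo the \<open>l\<close>-th power of the uniformizer \<open>w\<close>.\<close>

definition residue_reps :: "nat \<Rightarrow> 'k::field \<Rightarrow> nat \<Rightarrow> 'k set" where
  "residue_reps p w l = {\<Sum>j<l. of_nat (a j) * w ^ j | a. \<forall>j<l. a j < p}"

definition character_group ::
    "nat \<Rightarrow> 'k::{field,metric_space} \<Rightarrow> ('k \<Rightarrow> complex) \<Rightarrow> ('k \<Rightarrow> complex) set" where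
  "character_group p w chi =
     {(\<lambda>x\<in>integers. chi (w powi (- int l) * a * x)) | l a. l > 0 \<and> a \<in> residue_reps p w l}
     \<union> {(\<lambda>x\<in>integers. 1)}"

text \<open>
  Greedy base-\<open>p\<close> digits: \<open>greedy_rem p x i\<close> is \<open>p^i\<close> times the remainder after \<open>i\<close> digits,
  and the next digit is the largest \<open>d < p\<close> with \<open>d \<le> p * greedy_rem p x i\<close>.  The bound
  \<open>p - 1\<close> matters for \<open>x = 1\<close> only, where it makes every digit \<open>p - 1\<close>.
\<close>

primrec greedy_rem :: "nat \<Rightarrow> real \<Rightarrow> nat \<Rightarrow> real" where
  "greedy_rem p x 0 = x"
| "greedy_rem p x (Suc i) =
     real p * greedy_rem p x i - real (min (p - 1) (nat \<lfloor>real p * greedy_rem p x i\<rfloor>))"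

definition greedy_digit :: "nat \<Rightarrow> real \<Rightarrow> nat \<Rightarrow> nat" where
  "greedy_digit p x i = min (p - 1) (nat \<lfloor>real p * greedy_rem p x i\<rfloor>)"

definition rho :: "nat \<Rightarrow> 'k::{field,metric_space} \<Rightarrow> real \<Rightarrow> 'k" where
  "rho p w x = (\<Sum>i. of_nat (greedy_digit p x i) * w ^ i)"

definition omega ::
    "nat \<Rightarrow> 'k::{field,metric_space} \<Rightarrow> ('k \<Rightarrow> complex) \<Rightarrow> 'k \<Rightarrow> nat \<Rightarrow> real \<Rightarrow> complex" where
  "omega p w chi a l = (\<lambda>x\<in>{0..1}. chi (w powi (- int l) * a * rho p w x))"

definition omega_system ::
    "nat \<Rightarrow> 'k::{field,metric_space} \<Rightarrow> ('k \<Rightarrow> complex) \<Rightarrow> (real \<Rightarrow> complex) set" where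
  "omega_system p w chi =
     {omega p w chi a l | a l. l > 0 \<and> a \<in> residue_reps p w l} \<union> {(\<lambda>x\<in>{0..1}. 1)}"

end

theory Submission
  imports Defs
begin

text \<open>
  On either field \<open>dist x 0\<close> is a discrete non-archimedean absolute value, and the residue
  classes modulo \<open>w^n\<close> form \<open>p^n\<close> cylinders of the ring of integers.  Translation
  invariance gives all of them the same Haar measure \<open>p^(-n)\<close>.  The map \<open>rho\<close> pulls them back
  to the intervals of numbers with prescribed first \<open>n\<close> digits: these have length at most \<open>p^(-n)\<close>
  and their lengths sum to 1, so they have Lebesgue measure exactly \<open>p^(-n)\<close>.
  Both parts are therefore the same statement about a measure space carrying a map \<open>phi\<close> into
  the integers whose cylinders have measure \<open>p^(-n)\<close>.  Orthonormality holds because the integral of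
  a character is the average over residues modulo \<open>w^n\<close>, a sum that vanishes unless the character is
  trivial.  Conversely, the same character sums write the indicator of a cylinder as a finite
  combination of characters; a monotone class argument extends this to closures containing all
  indicators of measurable sets, and simple functions are dense.
\<close>

section \<open>Digit expansions in a discretely valued field\<close>

text \<open>All estimates compare \<open>N x\<close> with powers of \<open>N w\<close>, so one
  locale covers both absolute values: \<open>N w\<close> is \<open>1/p\<close> for the p-adic
  numbers and \<open>1/2\<close> for Laurent series. Completeness of the field enters as convergence
  of digit series. Different pairs \<open>(l, a)\<close> can give the same function. Orthogonality
  is arranged so that this need not be decided: two members that differ as functions differ at some
  point, and the value of the coding there is a translation that kills the character sum. Totality
  rests on the dual fact that an integer \<open>y\<close> outside the ideal of \<open>w ^ n\<close>
  is detected at level \<open>n\<close>: multiplying \<open>y / w ^ n\<close> by a suitable element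
  of the ring of integers gives \<open>inverse w\<close>, where \<open>chi\<close> is nontrivial.
  The p-adic character is defined through digits selected by a definite description, so uniqueness
  of two-sided expansions has to come before additivity. After that, any fraction with denominator a
  power of \<open>p\<close> that is congruent to \<open>x\<close> modulo the integers computes
  \<open>padic_char x\<close>.\<close>

locale digit_field =
  fixes p :: nat and w :: "'k::{field,metric_space}"
  assumes p_gt_1: "1 < p"
    and dist_translate: "dist x y = dist (x - y) (0::'k)"
    and dist_mult: "dist (x * y) (0::'k) = dist x 0 * dist y 0"
    and dist_ultra: "dist (x + y) (0::'k) \<le> max (dist x 0) (dist y 0)"
    and dist_w: "0 < dist w 0" "dist w 0 < 1"
    and dist_discrete: "dist x (0::'k) < 1 \<Longrightarrow> dist x 0 \<le> dist w 0"
    and dist_digit: "0 < d \<Longrightarrow> d < p \<Longrightarrow> dist (of_nat d) (0::'k) = 1"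
    and digit_exists: "dist x (0::'k) \<le> 1 \<Longrightarrow> \<exists>d<p. dist (x - of_nat d) 0 < 1"
    and digit_series: "(\<And>i. a i < p) \<Longrightarrow> \<exists>s. (\<lambda>i. of_nat (a i) * w ^ i) sums s"
begin

section \<open>Ultrametric arithmetic and the ring of integers\<close>

definition N :: "'k \<Rightarrow> real" where "N x = dist x 0"

definition digit_sum :: "(nat \<Rightarrow> nat) \<Rightarrow> nat \<Rightarrow> 'k" where
  "digit_sum a n = (\<Sum>i<n. of_nat (a i) * w ^ i)"

lemma N_0 [simp]: "N 0 = 0" and N_ge_0 [simp]: "0 \<le> N x" and N_eq_0 [simp]: "N x = 0 \<longleftrightarrow> x = 0"
  by (simp_all add: N_def)

lemma N_mult: "N (x * y) = N x * N y"
  by (simp add: N_def dist_mult)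

lemma N_1 [simp]: "N 1 = 1"
  using N_mult[of 1 1] N_eq_0[of 1] by simp

lemma N_uminus [simp]: "N (- x) = N x"
  using dist_translate[of 0 x] by (simp add: N_def dist_commute)

lemma N_minus_commute: "N (x - y) = N (y - x)"
  using N_uminus[of "x - y"] by simp

lemma N_add: "N (x + y) \<le> max (N x) (N y)"
  by (simp add: N_def dist_ultra)

lemma N_diff: "N (x - y) \<le> max (N x) (N y)"
  using N_add[of x "- y"] by simp

lemma N_add_le: "N x \<le> c \<Longrightarrow> N y \<le> c \<Longrightarrow> N (x + y) \<le> c"
  using N_add[of x y] by simp

lemma N_diff_le: "N x \<le> c \<Longrightarrow> N y \<le> c \<Longrightarrow> N (x - y) \<le> c"
  using N_diff[of x y] by simp

lemma N_triangle_le: "N (x - y) \<le> c \<Longrightarrow> N (y - z) \<le> c \<Longrightarrow> N (x - z) \<le> c"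
  using N_add_le[of "x - y" c "y - z"] by simp

lemma dist_eq_N: "dist x y = N (x - y)"
  by (simp add: N_def dist_translate[of x y])

lemma N_w: "0 < N w" "N w < 1" "w \<noteq> 0"
  using dist_w by (auto simp: N_def)

lemma N_inverse: "N (inverse x) = inverse (N x)"
proof (cases "x = 0")
  case False
  then have "N x * N (inverse x) = 1"
    by (simp flip: N_mult)
  then show ?thesis using inverse_unique by metis
qed simp

lemma N_divide: "N (x / y) = N x / N y"
  by (simp add: divide_inverse N_mult N_inverse)

lemma N_power [simp]: "N (x ^ n) = N x ^ n"
  by (induction n) (simp_all add: N_mult)

lemma N_powi [simp]: "N (x powi k) = N x powi k"
  by (simp add: power_int_def N_inverse)

lemma mem_integers: "x \<in> integers \<longleftrightarrow> N x \<le> 1"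
  by (simp add: integers_def N_def dist_commute)

lemma N_of_nat_le [simp]: "N (of_nat n) \<le> 1"
  by (induction n) (auto intro!: N_add_le)

lemma integers_add: "x \<in> integers \<Longrightarrow> y \<in> integers \<Longrightarrow> x + y \<in> (integers :: 'k set)"
  and integers_diff: "x \<in> integers \<Longrightarrow> y \<in> integers \<Longrightarrow> x - y \<in> (integers :: 'k set)"
  and integers_mult: "x \<in> integers \<Longrightarrow> y \<in> integers \<Longrightarrow> x * y \<in> (integers :: 'k set)"
  and integers_of_nat: "of_nat n \<in> (integers :: 'k set)"
  and integers_0: "0 \<in> (integers :: 'k set)"
  by (simp_all add: mem_integers N_add_le N_diff_le N_mult mult_le_one)

lemma integers_w_power: "w ^ n \<in> integers"
  using N_w by (simp add: mem_integers power_le_one)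

lemma integers_sum: "(\<And>i. i \<in> A \<Longrightarrow> f i \<in> integers) \<Longrightarrow> sum f A \<in> (integers :: 'k set)"
  by (induction A rule: infinite_finite_induct) (simp_all add: integers_0 integers_add)

lemma digit_sum_integers: "digit_sum a n \<in> integers"
  unfolding digit_sum_def
  by (intro integers_sum integers_mult integers_of_nat integers_w_power)

lemma digit_sum_Suc_shift: "digit_sum a (Suc n) = of_nat (a 0) + w * digit_sum (\<lambda>i. a (Suc i)) n"
  unfolding digit_sum_def sum.lessThan_Suc_shift by (simp add: sum_distrib_left mult_ac)

lemma N_le_powi_iff: "N x \<le> N w powi k \<longleftrightarrow> w powi (- k) * x \<in> integers"
proof -
  have "0 < N w powi k" using N_w by simp
  then show ?thesis
    by (simp add: mem_integers N_mult N_inverse power_int_minus divide_inverse) (simp add: field_simps)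
qed

lemma N_le_power_iff: "N x \<le> N w ^ n \<longleftrightarrow> w powi (- int n) * x \<in> integers"
  using N_le_powi_iff[of x "int n"] by simp

lemma N_less_1: "N x < 1 \<Longrightarrow> N x \<le> N w"
  using dist_discrete by (simp add: N_def)

section \<open>Uniqueness, existence and convergence of digit expansions\<close>

text \<open>The difference of two distinct digits is, up to sign, again a nonzero digit, and those
  have absolute value 1.\<close>

lemma digits_eqI:
  assumes "a < p" "b < p" "N (of_nat a - of_nat b) < 1"
  shows "a = b"
proof (rule ccontr)
  assume "a \<noteq> b"
  have *: False if "c < d" "d < p" "N (of_nat d - of_nat c) < 1" for c d
    using that dist_digit[of "d - c"] less_imp_diff_less[of d p c] by (simp add: of_nat_diff N_def)
  show False
    using *[of a b] *[of b a] \<open>a \<noteq> b\<close> assms N_minus_commute[of "of_nat a"] by (cases "a < b") auto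
qed

text \<open>Modulo \<open>w\<close> only the lowest digits survive, so they agree; they then cancel,
  and dividing by \<open>w\<close> leaves the same claim for one digit less.\<close>

lemma digit_sum_unique:
  assumes "\<And>i. i < n \<Longrightarrow> a i < p" "\<And>i. i < n \<Longrightarrow> b i < p"
    and "N (digit_sum a n - digit_sum b n) \<le> N w ^ n" "i < n"
  shows "a i = b i"
  using assms
proof (induction n arbitrary: a b i)
  case (Suc n)
  let ?a = "\<lambda>i. a (Suc i)" and ?b = "\<lambda>i. b (Suc i)"
  have eq: "digit_sum a (Suc n) - digit_sum b (Suc n) =
      of_nat (a 0) - of_nat (b 0) + w * (digit_sum ?a n - digit_sum ?b n)"
    by (simp add: digit_sum_Suc_shift algebra_simps)
  have "N (w * (digit_sum ?a n - digit_sum ?b n)) \<le> N w"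
    using integers_diff[OF digit_sum_integers digit_sum_integers, of ?a n ?b n] N_w
    by (simp add: N_mult mem_integers)
  moreover have "N w ^ Suc n \<le> N w"
    using N_w power_le_one[of "N w" n] by simp
  ultimately have "N (of_nat (a 0) - of_nat (b 0)) \<le> N w"
    using N_diff_le[of "digit_sum a (Suc n) - digit_sum b (Suc n)" "N w"
        "w * (digit_sum ?a n - digit_sum ?b n)"] Suc.prems(3) eq by simp
  then have 0: "a 0 = b 0"
    using Suc.prems(1,2)[of 0] N_w by (intro digits_eqI) auto
  with Suc.prems(3) eq have "N (digit_sum ?a n - digit_sum ?b n) \<le> N w ^ n"
    using N_w by (simp add: N_mult)
  then have "i = Suc j \<Longrightarrow> j < n \<Longrightarrow> ?a j = ?b j" for j
    using Suc.IH[of ?a ?b j] Suc.prems(1,2) by simp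
  with 0 Suc.prems(4) show ?case by (cases i) auto
qed simp

lemma digit_sum_exists:
  assumes "x \<in> integers"
  obtains a where "\<And>i. a i < p" "\<And>n. N (x - digit_sum a n) \<le> N w ^ n"
proof -
  define d where "d y = (SOME d. d < p \<and> N (y - of_nat d) < 1)" for y
  have d: "d y < p \<and> N (y - of_nat (d y)) < 1" if "y \<in> integers" for y
    unfolding d_def using digit_exists[of y] that by - (rule someI_ex, auto simp: mem_integers N_def)
  \<comment> \<open>Iterated division with remainder: \<open>y n\<close> is what is left of
    \<open>x\<close> after \<open>n\<close> digits, divided by \<open>w ^ n\<close>.\<close>
  define y where "y = rec_nat x (\<lambda>_ y. (y - of_nat (d y)) / w)"
  have y_simps: "y 0 = x" "y (Suc n) = (y n - of_nat (d (y n))) / w" for n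
    by (simp_all add: y_def)
  have y: "y n \<in> integers" for n
  proof (induction n)
    case (Suc n)
    \<comment> \<open>Discreteness improves \<open>< 1\<close> to \<open>\<le> N w\<close>, which
      keeps the quotient by \<open>w\<close> an integer.\<close>
    then have "N (y n - of_nat (d (y n))) \<le> N w"
      by (rule N_less_1[OF conjunct2[OF d]])
    then show ?case
      using N_w by (simp add: y_simps mem_integers N_divide divide_le_eq)
  qed (simp add: y_simps assms)
  have "x - digit_sum (\<lambda>i. d (y i)) n = w ^ n * y n" for n
  proof (induction n)
    case (Suc n)
    have "w * y (Suc n) = y n - of_nat (d (y n))"
      using N_w by (simp add: y_simps)
    then have "w ^ n * (w * y (Suc n)) = w ^ n * y n - w ^ n * of_nat (d (y n))"
      by (simp only: right_diff_distrib)
    then have "w ^ Suc n * y (Suc n) = w ^ n * y n - w ^ n * of_nat (d (y n))"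
      by (simp only: power_Suc2 mult.assoc)
    with Suc show ?case
      by (simp add: digit_sum_def algebra_simps)
  qed (simp add: digit_sum_def y_simps)
  then have "N (x - digit_sum (\<lambda>i. d (y i)) n) \<le> N w ^ n" for n
    using y[of n] N_w by (simp add: N_mult mem_integers)
  moreover have "d (y n) < p" for n
    by (rule conjunct1[OF d[OF y]])
  ultimately show ?thesis by (rule that[rotated])
qed

text \<open>By the ultrametric inequality the whole tail is no larger than the bound for its first
  term.\<close>

lemma digit_sum_tail:
  assumes "m \<le> n"
  shows "N (digit_sum a n - digit_sum a m) \<le> N w ^ m"
  using assms
proof (induction n rule: dec_induct)
  case base
  show ?case using N_w by simp
next
  case (step n)
  have "N (of_nat (a n)) * N w ^ n \<le> 1 * N w ^ m"
    using step.hyps N_w by (intro mult_mono power_decreasing) auto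
  then have "N (of_nat (a n) * w ^ n) \<le> N w ^ m"
    by (simp add: N_mult)
  from N_add_le[OF step.IH this] show ?case
    by (simp add: digit_sum_def algebra_simps)
qed

lemma digit_series_tail:
  assumes "(\<lambda>i. of_nat (a i) * w ^ i) sums s"
  shows "N (s - digit_sum a n) \<le> N w ^ n"
proof -
  have "(\<lambda>m. digit_sum a m) \<longlonglongrightarrow> s"
    using assms by (simp add: sums_def digit_sum_def)
  moreover have "\<forall>\<^sub>F m in sequentially. digit_sum a m \<in> cball (digit_sum a n) (N w ^ n)"
    using digit_sum_tail by (auto simp: eventually_sequentially dist_eq_N N_minus_commute[of "digit_sum a n"])
  ultimately have "s \<in> cball (digit_sum a n) (N w ^ n)"
    by (metis closed_cball Lim_in_closed_set trivial_limit_sequentially)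
  then show ?thesis by (simp add: dist_eq_N N_minus_commute)
qed

lemma N_w_power_tendsto_0: "(\<lambda>n. N w ^ n) \<longlonglongrightarrow> 0"
  using N_w by (intro LIMSEQ_power_zero) auto

lemma sums_digit_sumI:
  assumes "\<And>n. N (s - digit_sum a n) \<le> N w ^ n"
  shows "(\<lambda>i. of_nat (a i) * w ^ i) sums s"
proof -
  have "(\<lambda>n. dist (digit_sum a n) s) \<longlonglongrightarrow> 0"
    using assms by (intro tendsto_sandwich[OF _ _ tendsto_const N_w_power_tendsto_0] always_eventually)
      (auto simp: dist_eq_N N_minus_commute[of _ s])
  then show ?thesis
    unfolding sums_def digit_sum_def[symmetric] by (rule tendsto_dist_iff[THEN iffD2])
qed

end

section \<open>Residues and character sums\<close>

context digit_field
begin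

section \<open>Representatives modulo powers of the uniformizer\<close>

lemma residue_reps_eq: "residue_reps p w n = (\<lambda>a. digit_sum a n) ` {a. \<forall>j<n. a j < p}"
  by (auto simp: residue_reps_def digit_sum_def)

lemma digit_sum_cong: "(\<And>i. i < n \<Longrightarrow> a i = b i) \<Longrightarrow> digit_sum a n = digit_sum b n"
  by (simp add: digit_sum_def)

text \<open>Fixing the digits from \<open>n\<close> on to be \<open>undefined\<close> makes the
  parametrization injective with a finite domain, so the representatives can be counted.\<close>

lemma residue_reps_eq_PiE: "residue_reps p w n = (\<lambda>a. digit_sum a n) ` ({..<n} \<rightarrow>\<^sub>E {..<p})"
proof
  show "residue_reps p w n \<subseteq> (\<lambda>a. digit_sum a n) ` ({..<n} \<rightarrow>\<^sub>E {..<p})"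
  proof
    fix r assume "r \<in> residue_reps p w n"
    then obtain a where a: "r = digit_sum a n" "\<forall>j<n. a j < p" by (auto simp: residue_reps_eq)
    then have "r = digit_sum (restrict a {..<n}) n" by (auto intro: digit_sum_cong)
    with a(2) show "r \<in> (\<lambda>a. digit_sum a n) ` ({..<n} \<rightarrow>\<^sub>E {..<p})" by auto
  qed
qed (auto simp: residue_reps_eq PiE_def Pi_def)

lemma inj_on_digit_sum: "inj_on (\<lambda>a. digit_sum a n) ({..<n} \<rightarrow>\<^sub>E {..<p})"
proof (rule inj_onI)
  fix a b assume ab: "a \<in> {..<n} \<rightarrow>\<^sub>E {..<p}" "b \<in> {..<n} \<rightarrow>\<^sub>E {..<p}" "digit_sum a n = digit_sum b n"
  have "a i = b i" if "i < n" for i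
    using that ab N_w by (intro digit_sum_unique[of n a b]) (auto simp: PiE_def Pi_def)
  with ab(1,2) show "a = b" by (intro PiE_ext[of a "{..<n}" _ b]) auto
qed

lemma finite_residue_reps: "finite (residue_reps p w n)"
  unfolding residue_reps_eq_PiE by (intro finite_imageI finite_PiE) auto

lemma card_residue_reps: "card (residue_reps p w n) = p ^ n"
  unfolding residue_reps_eq_PiE card_image[OF inj_on_digit_sum] by (simp add: card_PiE)

lemma residue_reps_integers: "r \<in> residue_reps p w n \<Longrightarrow> r \<in> integers"
  by (auto simp: residue_reps_eq digit_sum_integers)

lemma residue_reps_exists:
  assumes "x \<in> integers"
  obtains r where "r \<in> residue_reps p w n" "N (x - r) \<le> N w ^ n"
proof -
  obtain a where "\<And>i. a i < p" "\<And>n. N (x - digit_sum a n) \<le> N w ^ n"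
    using digit_sum_exists[OF assms] by blast
  then show ?thesis using that[of "digit_sum a n"] by (auto simp: residue_reps_eq)
qed

lemma residue_reps_unique:
  assumes "r \<in> residue_reps p w n" "s \<in> residue_reps p w n" "N (r - s) \<le> N w ^ n"
  shows "r = s"
proof -
  obtain a b where ab: "r = digit_sum a n" "s = digit_sum b n" "\<forall>j<n. a j < p" "\<forall>j<n. b j < p"
    using assms(1,2) by (auto simp: residue_reps_eq)
  then have "a i = b i" if "i < n" for i
    using that assms(3) by (intro digit_sum_unique[of n a b]) auto
  then show ?thesis unfolding ab by (rule digit_sum_cong)
qed

definition rep :: "nat \<Rightarrow> 'k \<Rightarrow> 'k" where
  "rep n x = (SOME r. r \<in> residue_reps p w n \<and> N (x - r) \<le> N w ^ n)"

lemma rep: "x \<in> integers \<Longrightarrow> rep n x \<in> residue_reps p w n \<and> N (x - rep n x) \<le> N w ^ n"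
  unfolding rep_def by (rule someI_ex, rule residue_reps_exists[of x n]) auto

lemma rep_eqI: "x \<in> integers \<Longrightarrow> r \<in> residue_reps p w n \<Longrightarrow> N (x - r) \<le> N w ^ n \<Longrightarrow> rep n x = r"
  using rep[of x n] N_triangle_le[of "rep n x" x "N w ^ n" r]
  by (intro residue_reps_unique) (auto simp: N_minus_commute)

text \<open>Translation permutes the residue classes but not the chosen representatives;
  \<open>rep\<close> brings \<open>r + b\<close> back to its representative, which \<open>F\<close>
  does not notice.\<close>

lemma sum_residue_reps_shift:
  assumes F: "\<And>x y. x \<in> integers \<Longrightarrow> y \<in> integers \<Longrightarrow> N (x - y) \<le> N w ^ n \<Longrightarrow> F x = F y"
    and b: "b \<in> integers"
  shows "(\<Sum>r\<in>residue_reps p w n. F (r + b)) = (\<Sum>r\<in>residue_reps p w n. F r)"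
proof (rule sum.reindex_bij_witness)
  fix r assume r: "r \<in> residue_reps p w n"
  note ri = residue_reps_integers[OF r]
  show "rep n (r + b) \<in> residue_reps p w n" "rep n (r - b) \<in> residue_reps p w n"
    using rep integers_add[OF ri b] integers_diff[OF ri b] by blast+
  show "rep n (rep n (r + b) - b) = r"
  proof (rule rep_eqI[OF _ r])
    show "rep n (r + b) - b \<in> integers"
      using rep integers_add[OF ri b] residue_reps_integers b integers_diff by blast
    show "N (rep n (r + b) - b - r) \<le> N w ^ n"
      using rep[OF integers_add[OF ri b], of n] by (simp add: N_minus_commute algebra_simps)
  qed
  show "rep n (rep n (r - b) + b) = r"
  proof (rule rep_eqI[OF _ r])
    show "rep n (r - b) + b \<in> integers"
      using rep integers_diff[OF ri b] residue_reps_integers b integers_add by blast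
    show "N (rep n (r - b) + b - r) \<le> N w ^ n"
      using rep[OF integers_diff[OF ri b], of n] by (simp add: N_minus_commute algebra_simps)
  qed
  show "F (rep n (r + b)) = F (r + b)"
    using rep[OF integers_add[OF ri b], of n] residue_reps_integers integers_add[OF ri b]
    by (intro F) (auto simp: N_minus_commute)
qed

end

section \<open>Character sums over residues\<close>

locale digit_character = digit_field p w for p :: nat and w :: "'k::{field,metric_space}" +
  fixes chi :: "'k \<Rightarrow> complex"
  assumes chi_add: "chi (x + y) = chi x * chi y"
    and norm_chi: "cmod (chi x) = 1"
    and chi_integers: "x \<in> integers \<Longrightarrow> chi x = 1"
    and chi_nontrivial: "chi (inverse w) \<noteq> 1"
begin

lemma chi_cnj: "cnj (chi x) = chi (- x)"
proof -
  have "chi x * chi (- x) = 1"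
    using chi_integers[OF integers_0] by (simp flip: chi_add)
  moreover have "chi x * cnj (chi x) = 1"
    using norm_chi[of x] by (simp add: complex_norm_square[symmetric])
  ultimately show ?thesis
    by (metis mult.left_commute mult_1_right)
qed

lemma chi_cong:
  assumes "x - y \<in> integers" shows "chi x = chi y"
  using chi_add[of "x - y" y] chi_integers[OF assms] by simp

text \<open>The first hypothesis records the level of the frequency \<open>c\<close>: as
  \<open>c * w ^ n\<close> is an integer, changing \<open>y\<close> modulo \<open>w ^ n\<close>
  changes \<open>c * y\<close> by an integer.\<close>

lemma chi_locally_constant:
  assumes "N c * N w ^ n \<le> 1" "N (y - z) \<le> N w ^ n"
  shows "chi (c * y) = chi (c * z)"
proof (rule chi_cong)
  have "N c * N (y - z) \<le> N c * N w ^ n"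
    using assms by (intro mult_left_mono) auto
  with assms show "c * y - c * z \<in> integers"
    by (simp add: mem_integers N_mult flip: right_diff_distrib)
qed

text \<open>
  Translating the index of summation by \<open>x\<close> multiplies the sum by
  \<open>chi (c * x) \<noteq> 1\<close>, so the sum vanishes.
\<close>

lemma sum_chi_eq_0:
  assumes c: "N c * N w ^ n \<le> 1" and x: "x \<in> integers" "chi (c * x) \<noteq> 1"
  shows "(\<Sum>r\<in>residue_reps p w n. chi (c * r)) = 0"
proof -
  let ?S = "\<Sum>r\<in>residue_reps p w n. chi (c * r)"
  have "?S = (\<Sum>r\<in>residue_reps p w n. chi (c * (r + x)))"
    using chi_locally_constant[OF c] x by (intro sum_residue_reps_shift[symmetric]) auto
  also have "\<dots> = ?S * chi (c * x)"
    by (simp add: distrib_left chi_add sum_distrib_right)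
  finally have "?S * (chi (c * x) - 1) = 0"
    by (simp add: algebra_simps)
  with x show ?thesis by simp
qed

text \<open>Dual orthogonality: the point \<open>y\<close> is fixed and the frequency
  \<open>a\<close> varies. As the product is symmetric in both, \<open>sum_chi_eq_0\<close> applies
  with their roles exchanged.\<close>

lemma sum_chi_residue_reps:
  assumes y: "y \<in> integers"
  shows "(\<Sum>a\<in>residue_reps p w n. chi (w powi (- int n) * a * y))
    = (if N y \<le> N w ^ n then of_nat (p ^ n) else 0)"
proof (cases "N y \<le> N w ^ n")
  case True
  have "chi (w powi (- int n) * a * y) = 1" if "a \<in> residue_reps p w n" for a
  proof (rule chi_integers)
    have "w powi (- int n) * y * a \<in> integers"
      using True residue_reps_integers[OF that] by (intro integers_mult[of "w powi (- int n) * y" a]) (simp_all only: N_le_power_iff)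
    then show "w powi (- int n) * a * y \<in> integers" by (simp add: mult_ac)
  qed
  then show ?thesis using True by (simp add: card_residue_reps)
next
  case False
  have nz: "y \<noteq> 0" using False N_w by auto
  \<comment> \<open>Chosen so that \<open>w powi (- int n) * y * x\<close> is
    \<open>inverse w\<close>. Since \<open>N y > N w ^ n\<close>, discreteness gives
    \<open>N (w ^ n / y) \<le> N w\<close>, so the further division by \<open>w\<close> still yields
    an integer.\<close>
  define x where "x = w ^ n / y / w"
  have "N x \<le> 1"
  proof -
    have "0 < N y" using nz N_ge_0[of y] N_eq_0[of y] by linarith
    then have "N (w ^ n / y) < 1" using False by (simp add: N_divide divide_less_eq)
    from N_less_1[OF this] show ?thesis
      using N_w by (simp only: x_def N_divide[of _ w] divide_le_eq) simp
  qed
  then have x: "x \<in> integers" by (simp add: mem_integers)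
  have eq: "w powi (- int n) * y * x = inverse w"
    using N_w nz by (simp add: x_def power_int_minus field_simps)
  have "N (w powi (- int n) * y) * N w ^ n \<le> 1"
    using y N_w by (simp add: N_mult mem_integers power_int_minus N_inverse mult_ac)
  from sum_chi_eq_0[OF this x] have "(\<Sum>a\<in>residue_reps p w n. chi (w powi (- int n) * y * a)) = 0"
    using chi_nontrivial eq by simp
  then show ?thesis using False by (simp add: mult_ac)
qed

end

section \<open>Closed spans in spaces of square-integrable functions\<close>

lemma L2_measurable: "f \<in> L2 M \<Longrightarrow> f \<in> borel_measurable M"
  and L2_integrable: "f \<in> L2 M \<Longrightarrow> integrable M (\<lambda>x. (cmod (f x))\<^sup>2)"
  by (simp_all add: L2_def)

lemma cmod_add_square_le: "(cmod (a + b))\<^sup>2 \<le> 2 * (cmod a)\<^sup>2 + 2 * (cmod b)\<^sup>2"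
proof -
  have "(cmod (a + b))\<^sup>2 \<le> (cmod a + cmod b)\<^sup>2"
    by (intro power_mono norm_triangle_ineq) simp
  also have "\<dots> \<le> 2 * (cmod a)\<^sup>2 + 2 * (cmod b)\<^sup>2"
    using sum_squares_bound[of "cmod a" "cmod b"] by (simp add: power2_sum)
  finally show ?thesis .
qed

lemma L2_add:
  assumes "f \<in> L2 M" "g \<in> L2 M"
  shows "(\<lambda>x. f x + g x) \<in> L2 M"
proof -
  have [measurable]: "f \<in> borel_measurable M" "g \<in> borel_measurable M"
    using assms by (auto dest: L2_measurable)
  have "integrable M (\<lambda>x. (cmod (f x + g x))\<^sup>2)"
  proof (rule Bochner_Integration.integrable_bound)
    show "integrable M (\<lambda>x. 2 * (cmod (f x))\<^sup>2 + 2 * (cmod (g x))\<^sup>2)"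
      using assms by (intro Bochner_Integration.integrable_add integrable_mult_right L2_integrable)
    show "AE x in M. norm ((cmod (f x + g x))\<^sup>2) \<le> norm (2 * (cmod (f x))\<^sup>2 + 2 * (cmod (g x))\<^sup>2)"
      using cmod_add_square_le by (intro AE_I2) simp
  qed simp
  then show ?thesis by (simp add: L2_def)
qed

lemma L2_cmult: "f \<in> L2 M \<Longrightarrow> (\<lambda>x. c * f x) \<in> L2 M"
  by (auto simp: L2_def norm_mult power_mult_distrib)

lemma L2_diff: "f \<in> L2 M \<Longrightarrow> g \<in> L2 M \<Longrightarrow> (\<lambda>x. f x - g x) \<in> L2 M"
  using L2_add[of f M "\<lambda>x. - 1 * g x"] L2_cmult[of g M "-1"] by simp

lemma L2_0: "(\<lambda>x. 0) \<in> L2 M"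
  by (simp add: L2_def)

lemma L2_sum: "(\<And>i. i \<in> F \<Longrightarrow> f i \<in> L2 M) \<Longrightarrow> (\<lambda>x. \<Sum>i\<in>F. f i x) \<in> L2 M"
  by (induction F rule: infinite_finite_induct) (simp_all add: L2_0 L2_add)

lemma L2_cong: "(\<And>x. x \<in> space M \<Longrightarrow> f x = g x) \<Longrightarrow> f \<in> L2 M \<longleftrightarrow> g \<in> L2 M"
  unfolding L2_def by (simp cong: measurable_cong Bochner_Integration.integrable_cong)

lemma (in finite_measure) L2_bounded:
  assumes [measurable]: "f \<in> borel_measurable M" and "\<And>x. x \<in> space M \<Longrightarrow> cmod (f x) \<le> C"
  shows "f \<in> L2 M"
proof -
  have "integrable M (\<lambda>x. (cmod (f x))\<^sup>2)"
    using assms(2) by (intro integrable_const_bound[where B="C\<^sup>2"] AE_I2) (auto intro: power_mono)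
  then show ?thesis by (simp add: L2_def)
qed

lemma (in finite_measure) L2_indicator:
  assumes "A \<in> sets M" shows "(\<lambda>x. indicator A x :: complex) \<in> L2 M"
  using assms by (intro L2_bounded[where C=1]) (auto simp: indicator_def)

text \<open>With the squared distance, the pointwise bound \<open>cmod_add_square_le\<close>
  replaces the Minkowski inequality, at the price of a factor 2 in each triangle inequality.\<close>

definition L2_dist2 :: "'a measure \<Rightarrow> ('a \<Rightarrow> complex) \<Rightarrow> ('a \<Rightarrow> complex) \<Rightarrow> real" where
  "L2_dist2 M f g = (LINT x|M. (cmod (f x - g x))\<^sup>2)"

lemma L2_dist2_triangle:
  assumes "f \<in> L2 M" "g \<in> L2 M" "h \<in> L2 M"
  shows "L2_dist2 M f h \<le> 2 * L2_dist2 M f g + 2 * L2_dist2 M g h"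
proof -
  have *: "integrable M (\<lambda>x. (cmod (f x - g x))\<^sup>2)" "integrable M (\<lambda>x. (cmod (g x - h x))\<^sup>2)"
    "integrable M (\<lambda>x. (cmod (f x - h x))\<^sup>2)"
    using assms by (auto intro!: L2_integrable L2_diff)
  have "L2_dist2 M f h \<le> (LINT x|M. 2 * (cmod (f x - g x))\<^sup>2 + 2 * (cmod (g x - h x))\<^sup>2)"
    unfolding L2_dist2_def using * cmod_add_square_le[of "f x - g x" "g x - h x" for x]
    by (intro integral_mono) auto
  also have "\<dots> = 2 * L2_dist2 M f g + 2 * L2_dist2 M g h"
    unfolding L2_dist2_def using * by simp
  finally show ?thesis .
qed

lemma L2_dist2_add:
  assumes "f \<in> L2 M" "g \<in> L2 M" "f' \<in> L2 M" "g' \<in> L2 M"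
  shows "L2_dist2 M (\<lambda>x. f x + g x) (\<lambda>x. f' x + g' x) \<le> 2 * L2_dist2 M f f' + 2 * L2_dist2 M g g'"
proof -
  have "L2_dist2 M (\<lambda>x. f x + g x) (\<lambda>x. f' x + g' x)
    \<le> 2 * L2_dist2 M (\<lambda>x. f x + g x) (\<lambda>x. f' x + g x) + 2 * L2_dist2 M (\<lambda>x. f' x + g x) (\<lambda>x. f' x + g' x)"
    using assms by (intro L2_dist2_triangle L2_add)
  then show ?thesis by (simp add: L2_dist2_def)
qed

lemma L2_dist2_cmult: "L2_dist2 M (\<lambda>x. c * f x) (\<lambda>x. c * g x) = (cmod c)\<^sup>2 * L2_dist2 M f g"
  by (simp add: L2_dist2_def norm_mult power_mult_distrib flip: right_diff_distrib)

section \<open>Linear spans and their closures\<close>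

definition lin_span :: "('a \<Rightarrow> complex) set \<Rightarrow> ('a \<Rightarrow> complex) set" where
  "lin_span B = {\<lambda>x. \<Sum>b\<in>F. c b * b x | F c. finite F \<and> F \<subseteq> B}"

lemma lin_span_add:
  assumes "f \<in> lin_span B" "g \<in> lin_span B"
  shows "(\<lambda>x. f x + g x) \<in> lin_span B"
proof -
  obtain F c G d where fg: "finite F" "F \<subseteq> B" "f = (\<lambda>x. \<Sum>b\<in>F. c b * b x)"
    "finite G" "G \<subseteq> B" "g = (\<lambda>x. \<Sum>b\<in>G. d b * b x)"
    using assms unfolding lin_span_def by blast
  \<comment> \<open>Functions in both \<open>F\<close> and \<open>G\<close> must receive the sum of
    their two coefficients.\<close>
  define e where "e b = (if b \<in> F then c b else 0) + (if b \<in> G then d b else 0)" for b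
  have "(\<Sum>b\<in>F \<union> G. e b * b x) = f x + g x" for x
  proof -
    have "(\<Sum>b\<in>F \<union> G. e b * b x) = (\<Sum>b\<in>F \<union> G. if b \<in> F then c b * b x else 0)
        + (\<Sum>b\<in>F \<union> G. if b \<in> G then d b * b x else 0)"
      unfolding sum.distrib[symmetric] by (intro sum.cong) (auto simp: e_def algebra_simps)
    also have "(\<Sum>b\<in>F \<union> G. if b \<in> F then c b * b x else 0) = f x"
      unfolding fg using fg(1,4) by (intro sum.mono_neutral_cong_right) auto
    also have "(\<Sum>b\<in>F \<union> G. if b \<in> G then d b * b x else 0) = g x"
      unfolding fg using fg(1,4) by (intro sum.mono_neutral_cong_right) auto
    finally show ?thesis .
  qed
  then have "(\<lambda>x. f x + g x) = (\<lambda>x. \<Sum>b\<in>F \<union> G. e b * b x)" by simp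
  then show ?thesis unfolding lin_span_def using fg by blast
qed

lemma lin_span_cmult:
  assumes "f \<in> lin_span B"
  shows "(\<lambda>x. k * f x) \<in> lin_span B"
proof -
  obtain F c where F: "finite F" "F \<subseteq> B" "f = (\<lambda>x. \<Sum>b\<in>F. c b * b x)"
    using assms unfolding lin_span_def by blast
  then have "(\<lambda>x. k * f x) = (\<lambda>x. \<Sum>b\<in>F. (k * c b) * b x)"
    by (simp add: sum_distrib_left mult.assoc)
  with F(1,2) show ?thesis
    unfolding lin_span_def by (intro CollectI exI[of _ F] exI[of _ "\<lambda>b. k * c b"]) simp
qed

lemma lin_span_0: "(\<lambda>x. 0) \<in> lin_span B"
  unfolding lin_span_def by (intro CollectI exI[of _ "{}"]) simp

lemma lin_span_base: "b \<in> B \<Longrightarrow> b \<in> lin_span B"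
  unfolding lin_span_def by (intro CollectI exI[of _ "{b}"] exI[of _ "\<lambda>_. 1"]) simp

lemma lin_span_sum: "(\<And>i. i \<in> F \<Longrightarrow> f i \<in> lin_span B) \<Longrightarrow> (\<lambda>x. \<Sum>i\<in>F. f i x) \<in> lin_span B"
  by (induction F rule: infinite_finite_induct) (simp_all add: lin_span_0 lin_span_add)

lemma lin_span_L2: "B \<subseteq> L2 M \<Longrightarrow> f \<in> lin_span B \<Longrightarrow> f \<in> L2 M"
  unfolding lin_span_def by (auto intro!: L2_sum L2_cmult)

definition L2_closed_span :: "'a measure \<Rightarrow> ('a \<Rightarrow> complex) set \<Rightarrow> ('a \<Rightarrow> complex) set" where
  "L2_closed_span M B = {f \<in> L2 M. \<forall>\<epsilon>>0. \<exists>g\<in>lin_span B. L2_dist2 M f g < \<epsilon>}"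

lemma L2_closed_span_limit:
  assumes B: "B \<subseteq> L2 M" and f: "f \<in> L2 M"
    and approx: "\<And>\<epsilon>. \<epsilon> > 0 \<Longrightarrow> \<exists>g\<in>L2_closed_span M B. L2_dist2 M f g < \<epsilon>"
  shows "f \<in> L2_closed_span M B"
  unfolding L2_closed_span_def
proof (intro CollectI conjI f allI impI)
  fix \<epsilon> :: real assume "\<epsilon> > 0"
  \<comment> \<open>A quarter each, because the triangle inequality doubles both terms.\<close>
  then obtain g where g: "g \<in> L2_closed_span M B" "L2_dist2 M f g < \<epsilon> / 4"
    using approx[of "\<epsilon> / 4"] by auto
  then obtain h where h: "h \<in> lin_span B" "L2_dist2 M g h < \<epsilon> / 4"
    unfolding L2_closed_span_def using \<open>\<epsilon> > 0\<close> by (auto dest!: spec[of _ "\<epsilon> / 4"])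
  have "L2_dist2 M f h \<le> 2 * L2_dist2 M f g + 2 * L2_dist2 M g h"
    using f g(1) lin_span_L2[OF B h(1)] by (intro L2_dist2_triangle) (auto simp: L2_closed_span_def)
  with g h show "\<exists>g\<in>lin_span B. L2_dist2 M f g < \<epsilon>" by (intro bexI[of _ h]) auto
qed

lemma L2_closed_span_add:
  assumes B: "B \<subseteq> L2 M" and fg: "f \<in> L2_closed_span M B" "g \<in> L2_closed_span M B"
  shows "(\<lambda>x. f x + g x) \<in> L2_closed_span M B"
  unfolding L2_closed_span_def
proof (intro CollectI conjI allI impI)
  show "(\<lambda>x. f x + g x) \<in> L2 M"
    using fg by (intro L2_add) (auto simp: L2_closed_span_def)
  fix \<epsilon> :: real assume "\<epsilon> > 0"
  then obtain f' g' where *: "f' \<in> lin_span B" "L2_dist2 M f f' < \<epsilon> / 4"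
    "g' \<in> lin_span B" "L2_dist2 M g g' < \<epsilon> / 4"
    using fg unfolding L2_closed_span_def by (auto dest!: spec[of _ "\<epsilon> / 4"])
  have "L2_dist2 M (\<lambda>x. f x + g x) (\<lambda>x. f' x + g' x) \<le> 2 * L2_dist2 M f f' + 2 * L2_dist2 M g g'"
    using fg lin_span_L2[OF B *(1)] lin_span_L2[OF B *(3)]
    by (intro L2_dist2_add) (auto simp: L2_closed_span_def)
  with * show "\<exists>h\<in>lin_span B. L2_dist2 M (\<lambda>x. f x + g x) h < \<epsilon>"
    by (intro bexI[OF _ lin_span_add[OF *(1,3)]]) auto
qed

lemma L2_closed_span_cmult:
  assumes f: "f \<in> L2_closed_span M B"
  shows "(\<lambda>x. k * f x) \<in> L2_closed_span M B"
  unfolding L2_closed_span_def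
proof (intro CollectI conjI allI impI)
  show "(\<lambda>x. k * f x) \<in> L2 M"
    using f by (intro L2_cmult) (auto simp: L2_closed_span_def)
  fix \<epsilon> :: real assume "\<epsilon> > 0"
  \<comment> \<open>Adding 1 keeps the divisor positive for \<open>k = 0\<close>.\<close>
  then have "\<epsilon> / ((cmod k)\<^sup>2 + 1) > 0" by (intro divide_pos_pos) (auto intro: add_nonneg_pos)
  then obtain g where g: "g \<in> lin_span B" "L2_dist2 M f g < \<epsilon> / ((cmod k)\<^sup>2 + 1)"
    using f unfolding L2_closed_span_def by blast
  have "(cmod k)\<^sup>2 * L2_dist2 M f g \<le> ((cmod k)\<^sup>2 + 1) * L2_dist2 M f g"
    by (intro mult_right_mono) (auto simp: L2_dist2_def)
  also have "\<dots> < \<epsilon>"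
    using g(2) by (simp add: less_divide_eq mult.commute add_nonneg_pos)
  finally show "\<exists>h\<in>lin_span B. L2_dist2 M (\<lambda>x. k * f x) h < \<epsilon>"
    by (intro bexI[OF _ lin_span_cmult[OF g(1), of k]]) (simp add: L2_dist2_cmult)
qed

lemma L2_closed_span_base:
  assumes "B \<subseteq> L2 M" "f \<in> lin_span B"
  shows "f \<in> L2_closed_span M B"
  using assms lin_span_L2[OF assms] unfolding L2_closed_span_def
  by (auto intro!: bexI[of _ f] simp: L2_dist2_def)

text \<open>The distance to every element of the span ignores null sets. This admits functions known
  only almost everywhere, or only on \<open>space M\<close>.\<close>

lemma L2_closed_span_AE:
  assumes "f \<in> L2_closed_span M B" "g \<in> L2 M" "AE x in M. f x = g x" "B \<subseteq> L2 M"
  shows "g \<in> L2_closed_span M B"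
proof -
  have "L2_dist2 M g h = L2_dist2 M f h" if "h \<in> lin_span B" for h
  proof -
    have [measurable]: "f \<in> borel_measurable M" "g \<in> borel_measurable M" "h \<in> borel_measurable M"
      using assms lin_span_L2[OF assms(4) that] by (auto simp: L2_closed_span_def L2_measurable)
    show ?thesis
      unfolding L2_dist2_def using assms(3) by (intro integral_cong_AE) auto
  qed
  with assms(1,2) show ?thesis unfolding L2_closed_span_def by simp
qed

lemma L2_closed_span_sum:
  assumes "B \<subseteq> L2 M" "\<And>i. i \<in> F \<Longrightarrow> f i \<in> L2_closed_span M B"
  shows "(\<lambda>x. \<Sum>i\<in>F. f i x) \<in> L2_closed_span M B"
  using assms(2)
  by (induction F rule: infinite_finite_induct)
    (simp_all add: L2_closed_span_base[OF assms(1) lin_span_0] L2_closed_span_add[OF assms(1)])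

lemma (in finite_measure) L2_closed_span_indicators:
  assumes B: "B \<subseteq> L2 M"
    and ind: "\<And>A. A \<in> sets M \<Longrightarrow> (\<lambda>x. indicator A x) \<in> L2_closed_span M B"
    and f: "f \<in> L2 M"
  shows "f \<in> L2_closed_span M B"
proof -
  have [measurable]: "f \<in> borel_measurable M" using f by (rule L2_measurable)
  obtain s where "\<forall>i. simple_function M (s i)" "\<forall>x\<in>space M. (\<lambda>i. s i x) \<longlonglongrightarrow> f x"
    "\<forall>i. \<forall>x\<in>space M. dist (s i x) 0 \<le> 2 * dist (f x) 0"
    using borel_measurable_implies_sequence_metric[of f M 0] by auto
  then have s: "\<And>i. simple_function M (s i)" "\<And>x. x \<in> space M \<Longrightarrow> (\<lambda>i. s i x) \<longlonglongrightarrow> f x"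
    "\<And>i x. x \<in> space M \<Longrightarrow> cmod (s i x) \<le> 2 * cmod (f x)"
    by (simp_all add: dist_norm)
  have [measurable]: "s i \<in> borel_measurable M" for i
    using s(1) by (rule borel_measurable_simple_function)
  have "s i \<in> L2_closed_span M B" for i
  proof -
    \<comment> \<open>This combination of indicators agrees with \<open>s i\<close> on
      \<open>space M\<close> but vanishes outside, hence the detour through almost-everywhere
      equality.\<close>
    let ?g = "\<lambda>x. \<Sum>y\<in>s i ` space M. y * indicator (s i -` {y} \<inter> space M) x"
    have g: "?g \<in> L2_closed_span M B"
      using simple_functionD(2)[OF s(1)] by (intro L2_closed_span_sum B L2_closed_span_cmult ind)
    have eq: "?g x = s i x" if "x \<in> space M" for x
    proof -
      have "?g x = (\<Sum>y\<in>s i ` space M. if y = s i x then y else 0)"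
        using that by (intro sum.cong refl) (simp add: indicator_def)
      also have "\<dots> = s i x"
        using that by (simp add: sum.delta[OF simple_functionD(1)[OF s(1)]])
      finally show ?thesis .
    qed
    have "s i \<in> L2 M"
      using g L2_cong[of M ?g "s i", OF eq] by (simp add: L2_closed_span_def)
    with g show ?thesis by (rule L2_closed_span_AE) (auto simp: eq B)
  qed
  moreover have "(\<lambda>i. L2_dist2 M f (s i)) \<longlonglongrightarrow> (LINT x|M. 0)"
    unfolding L2_dist2_def
  \<comment> \<open>The constant 9 is the square of \<open>1 + 2\<close>: the approximants satisfy
    \<open>cmod (s i x) \<le> 2 * cmod (f x)\<close>.\<close>
  proof (rule integral_dominated_convergence[where w="\<lambda>x. 9 * (cmod (f x))\<^sup>2"])
    show "integrable M (\<lambda>x. 9 * (cmod (f x))\<^sup>2)" using L2_integrable[OF f] by simp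
    show "AE x in M. (\<lambda>i. (cmod (f x - s i x))\<^sup>2) \<longlonglongrightarrow> 0"
    proof (rule AE_I2)
      fix x assume "x \<in> space M"
      have "(\<lambda>i. (cmod (f x - s i x))\<^sup>2) \<longlonglongrightarrow> (cmod (f x - f x))\<^sup>2"
        by (intro tendsto_intros s(2) \<open>x \<in> space M\<close>)
      then show "(\<lambda>i. (cmod (f x - s i x))\<^sup>2) \<longlonglongrightarrow> 0" by simp
    qed
    show "AE x in M. norm ((cmod (f x - s i x))\<^sup>2) \<le> 9 * (cmod (f x))\<^sup>2" for i
    proof (rule AE_I2)
      fix x assume x: "x \<in> space M"
      have "cmod (f x - s i x) \<le> 3 * cmod (f x)"
        using norm_triangle_ineq4[of "f x" "s i x"] s(3)[OF x, of i] by simp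
      then have "(cmod (f x - s i x))\<^sup>2 \<le> (3 * cmod (f x))\<^sup>2" by (intro power_mono) auto
      then show "norm ((cmod (f x - s i x))\<^sup>2) \<le> 9 * (cmod (f x))\<^sup>2" by (simp add: power_mult_distrib)
    qed
  qed simp_all
  ultimately show ?thesis
  proof (intro L2_closed_span_limit[OF B f])
    fix \<epsilon> :: real
    assume *: "\<And>i. s i \<in> L2_closed_span M B" "(\<lambda>i. L2_dist2 M f (s i)) \<longlonglongrightarrow> (LINT x|M. 0)" "\<epsilon> > 0"
    then have "\<forall>\<^sub>F i in sequentially. L2_dist2 M f (s i) < \<epsilon>"
      by (intro order_tendstoD) auto
    then obtain i where "L2_dist2 M f (s i) < \<epsilon>"
      by (auto simp: eventually_sequentially)
    with * show "\<exists>g\<in>L2_closed_span M B. L2_dist2 M f g < \<epsilon>" by blast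
  qed
qed

section \<open>Characters pulled back along a measure-preserving coding\<close>

definition cylinder :: "'a measure \<Rightarrow> ('a \<Rightarrow> 'k) \<Rightarrow> 'k::{field,metric_space} \<Rightarrow> nat \<Rightarrow> 'k \<Rightarrow> 'a set" where
  "cylinder M phi w n r = {x\<in>space M. dist (phi x) r \<le> dist w 0 ^ n}"

text \<open>
  \<open>M\<close> is the ring of integers with \<open>phi\<close> the identity, or the unit interval with
  \<open>phi = rho p w\<close>.  Generation by cylinders is required only modulo null sets because Lebesgue
  measurable sets need not be Borel.
\<close>

locale digit_space = digit_character p w chi + finite_measure M
  for p :: nat and w :: "'k::{field,metric_space}" and chi :: "'k \<Rightarrow> complex"
    and M :: "'a measure" +
  fixes phi :: "'a \<Rightarrow> 'k"
  assumes phi_integers: "x \<in> space M \<Longrightarrow> phi x \<in> integers"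
    and cyl_sets: "r \<in> residue_reps p w n \<Longrightarrow> cylinder M phi w n r \<in> sets M"
    and measure_cyl: "r \<in> residue_reps p w n \<Longrightarrow> measure M (cylinder M phi w n r) = 1 / real p ^ n"
    and cyl_generate: "A \<in> sets M \<Longrightarrow> \<exists>B\<in>sigma_sets (space M) {cylinder M phi w n r | n r. r \<in> residue_reps p w n}.
      AE x in M. x \<in> A \<longleftrightarrow> x \<in> B"
begin

abbreviation cyl :: "nat \<Rightarrow> 'k \<Rightarrow> 'a set" where
  "cyl \<equiv> cylinder M phi w"

section \<open>Integrals of locally constant functions and orthonormality\<close>

definition psi :: "'k \<Rightarrow> 'a \<Rightarrow> complex" where
  "psi c = (\<lambda>x\<in>space M. chi (c * phi x))"

definition system :: "('a \<Rightarrow> complex) set" where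
  "system = {psi (w powi (- int l) * a) | l a. l > 0 \<and> a \<in> residue_reps p w l} \<union> {\<lambda>x\<in>space M. 1}"

lemma mem_cyl: "x \<in> cyl n r \<longleftrightarrow> x \<in> space M \<and> N (phi x - r) \<le> N w ^ n"
  by (simp add: cylinder_def dist_eq_N)

lemma psi_0: "psi 0 = (\<lambda>x\<in>space M. 1)"
  by (simp add: psi_def chi_integers integers_0)

text \<open>Level 0 has the single representative 0, which gives the constant function 1, so finite
  Fourier sums stay in the system at every level.\<close>

lemma psi_mem_system: "a \<in> residue_reps p w n \<Longrightarrow> psi (w powi (- int n) * a) \<in> system"
  by (cases "n = 0") (auto simp: system_def residue_reps_eq digit_sum_def psi_0)

text \<open>Forgets the pair \<open>(l, a)\<close> and keeps a frequency with a level; the constant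
  function gets frequency 0 and level 0.\<close>

lemma systemE:
  assumes "f \<in> system"
  obtains c n where "f = psi c" "N c * N w ^ n \<le> 1"
proof -
  have *: "N (w powi (- int l) * a) * N w ^ l \<le> 1" if "a \<in> residue_reps p w l" for l a
    using residue_reps_integers[OF that] N_w
    by (simp add: N_mult mem_integers power_int_minus N_inverse mult_ac)
  consider l a where "f = psi (w powi (- int l) * a)" "a \<in> residue_reps p w l" | "f = psi 0"
    using assms by (auto simp: system_def psi_0)
  then show ?thesis
  proof cases
    case 1
    then show ?thesis using that * by blast
  next
    case 2
    then show ?thesis using that[of 0 0] by simp
  qed
qed

lemma cyl_cover:
  assumes "x \<in> space M"
  shows "x \<in> cyl n r \<and> r \<in> residue_reps p w n \<longleftrightarrow> r = rep n (phi x)"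
  using rep[OF phi_integers[OF assms], of n] rep_eqI[OF phi_integers[OF assms]] assms
  by (auto simp: mem_cyl)

lemma locally_constant_eq_sum:
  assumes G: "\<And>y z. y \<in> integers \<Longrightarrow> z \<in> integers \<Longrightarrow> N (y - z) \<le> N w ^ n \<Longrightarrow> G y = (G z :: complex)"
    and x: "x \<in> space M"
  shows "G (phi x) = (\<Sum>r\<in>residue_reps p w n. indicator (cyl n r) x * G r)"
proof -
  let ?r = "rep n (phi x)"
  have r: "?r \<in> residue_reps p w n" "N (phi x - ?r) \<le> N w ^ n"
    using rep[OF phi_integers[OF x]] by blast+
  have "(\<Sum>r\<in>residue_reps p w n. indicator (cyl n r) x * G r)
      = (\<Sum>r\<in>residue_reps p w n. if r = ?r then G r else 0)"
    using cyl_cover[OF x] by (intro sum.cong refl) (auto simp: indicator_def)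
  also have "\<dots> = G ?r"
    using r(1) by (simp add: sum.delta[OF finite_residue_reps])
  also have "\<dots> = G (phi x)"
    using r residue_reps_integers phi_integers[OF x] by (intro G) (auto simp: N_minus_commute)
  finally show ?thesis by simp
qed

lemma
  assumes "\<And>y z. y \<in> integers \<Longrightarrow> z \<in> integers \<Longrightarrow> N (y - z) \<le> N w ^ n \<Longrightarrow> G y = (G z :: complex)"
  shows locally_constant_measurable: "(\<lambda>x. G (phi x)) \<in> borel_measurable M"
    and integral_locally_constant:
      "(LINT x|M. G (phi x)) = (\<Sum>r\<in>residue_reps p w n. G r) / of_nat (p ^ n)"
proof -
  let ?S = "\<lambda>x. \<Sum>r\<in>residue_reps p w n. indicator (cyl n r) x * G r"
  have eq: "G (phi x) = ?S x" if "x \<in> space M" for x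
    by (rule locally_constant_eq_sum[OF assms that])
  have "?S \<in> borel_measurable M"
    using cyl_sets by (intro borel_measurable_sum borel_measurable_times) auto
  then show "(\<lambda>x. G (phi x)) \<in> borel_measurable M"
    by (subst measurable_cong[OF eq])
  have int: "integrable M (\<lambda>x. indicator (cyl n r) x * G r)" "(LINT x|M. indicator (cyl n r) x * G r) = G r / of_nat (p ^ n)"
    if "r \<in> residue_reps p w n" for r
  proof -
    have "has_bochner_integral M (\<lambda>x. indicator (cyl n r) x *\<^sub>R G r) (measure M (cyl n r) *\<^sub>R G r)"
      using cyl_sets[OF that] by (intro has_bochner_integral_indicator) (simp_all add: emeasure_eq_measure)
    moreover have "indicator (cyl n r) x *\<^sub>R G r = indicator (cyl n r) x * G r" for x
      by (simp add: indicator_def)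
    moreover have "measure M (cyl n r) *\<^sub>R G r = G r / of_nat (p ^ n)"
      by (simp add: measure_cyl[OF that] scaleR_conv_of_real)
    ultimately have "has_bochner_integral M (\<lambda>x. indicator (cyl n r) x * G r) (G r / of_nat (p ^ n))"
      by simp
    then show "integrable M (\<lambda>x. indicator (cyl n r) x * G r)"
      "(LINT x|M. indicator (cyl n r) x * G r) = G r / of_nat (p ^ n)"
      by (rule integrable.intros has_bochner_integral_integral_eq)+
  qed
  have "(LINT x|M. G (phi x)) = (LINT x|M. ?S x)"
    by (rule Bochner_Integration.integral_cong[OF refl eq])
  also have "\<dots> = (\<Sum>r\<in>residue_reps p w n. G r / of_nat (p ^ n))"
    using int by (subst Bochner_Integration.integral_sum) auto
  finally show "(LINT x|M. G (phi x)) = (\<Sum>r\<in>residue_reps p w n. G r) / of_nat (p ^ n)"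
    by (simp add: sum_divide_distrib)
qed

lemma psi_L2:
  assumes "N c * N w ^ n \<le> 1"
  shows "psi c \<in> L2 M"
proof -
  have "(\<lambda>x. chi (c * phi x)) \<in> borel_measurable M"
    by (rule locally_constant_measurable[where G="\<lambda>y. chi (c * y)" and n=n]) (rule chi_locally_constant[OF assms])
  then have "(\<lambda>x. chi (c * phi x)) \<in> L2 M"
    by (rule L2_bounded[where C=1]) (simp add: norm_chi)
  then show ?thesis
    by (subst L2_cong[where g="\<lambda>x. chi (c * phi x)"]) (simp_all add: psi_def)
qed

lemma system_L2: "system \<subseteq> L2 M"
  by (auto elim!: systemE intro: psi_L2)

lemma system_orthonormal:
  assumes "f \<in> system" "g \<in> system"
  shows "L2_inner M f g = (if f = g then 1 else 0)"
proof -
  obtain c m where f: "f = psi c" "N c * N w ^ m \<le> 1" using assms(1) by (rule systemE)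
  obtain d k where g: "g = psi d" "N d * N w ^ k \<le> 1" using assms(2) by (rule systemE)
  \<comment> \<open>A common level at which both frequencies, hence also their difference, are
    locally constant.\<close>
  define n where "n = max m k"
  have "N w ^ n \<le> N w ^ m" "N w ^ n \<le> N w ^ k"
    using N_w by (auto intro!: power_decreasing simp: n_def)
  then have "N c * N w ^ n \<le> 1" "N d * N w ^ n \<le> 1"
    using f(2) g(2) by (meson N_ge_0 mult_left_mono order_trans)+
  then have cd: "N (c - d) * N w ^ n \<le> 1"
    using N_diff_le[of "c * w ^ n" 1 "d * w ^ n"] by (simp add: N_mult flip: left_diff_distrib)
  have "L2_inner M f g = (LINT x|M. chi ((c - d) * phi x))"
    unfolding L2_inner_def f g
    by (intro Bochner_Integration.integral_cong) (simp_all add: psi_def chi_cnj left_diff_distrib flip: chi_add)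
  also have eq: "\<dots> = (\<Sum>r\<in>residue_reps p w n. chi ((c - d) * r)) / of_nat (p ^ n)"
    by (rule integral_locally_constant[where G="\<lambda>y. chi ((c - d) * y)"]) (rule chi_locally_constant[OF cd])
  also have "\<dots> = (if f = g then 1 else 0)"
  proof (cases "f = g")
    case True
    \<comment> \<open>Equality of the functions does not give \<open>c = d\<close>, but it makes the
      character of frequency \<open>c - d\<close> trivial along \<open>phi\<close>.\<close>
    have "chi ((c - d) * phi x) = 1" if "x \<in> space M" for x
    proof -
      have "chi (c * phi x) = chi (d * phi x)"
        using True that unfolding f g psi_def by (metis restrict_apply')
      then have "chi (c * phi x) * cnj (chi (d * phi x)) = 1"
        using norm_chi[of "d * phi x"] by (simp add: complex_norm_square[symmetric])
      then show ?thesis by (simp add: chi_cnj left_diff_distrib flip: chi_add)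
    qed
    then have "(LINT x|M. chi ((c - d) * phi x)) = (LINT x|M. 1)"
      by (intro Bochner_Integration.integral_cong) auto
    \<comment> \<open>That the total mass is 1 is read off from the cylinder measures by averaging a
      constant.\<close>
    also have "\<dots> = (\<Sum>r\<in>residue_reps p w n. 1) / of_nat (p ^ n)"
      using integral_locally_constant[of n "\<lambda>_. 1"] by simp
    also have "\<dots> = 1" using p_gt_1 by (simp add: card_residue_reps)
    finally show ?thesis using True eq by simp
  next
    case False
    then obtain x where x: "f x \<noteq> g x" by blast
    \<comment> \<open>Outside \<open>space M\<close> both functions are \<open>undefined\<close> and
      cannot differ; so \<open>phi x\<close> is an integer and serves as the translation in
      \<open>sum_chi_eq_0\<close>.\<close>
    then have xs: "x \<in> space M" unfolding f g psi_def by (metis restrict_apply)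
    have "chi ((c - d) * phi x) \<noteq> 1"
    proof
      assume 1: "chi ((c - d) * phi x) = 1"
      have "chi (c * phi x) = chi ((c - d) * phi x) * chi (d * phi x)"
        by (simp add: left_diff_distrib flip: chi_add)
      with 1 x xs show False by (simp add: f g psi_def)
    qed
    from sum_chi_eq_0[OF cd phi_integers[OF xs] this] False show ?thesis by simp
  qed
  finally show ?thesis .
qed

section \<open>Totality: from cylinders to the generated sigma-algebra\<close>

lemma cyl_closed_span:
  assumes r: "r \<in> residue_reps p w n"
  shows "(\<lambda>x. indicator (cyl n r) x) \<in> L2_closed_span M system"
proof -
  let ?c = "\<lambda>a. w powi (- int n) * a"
  \<comment> \<open>Finite Fourier inversion: the coefficient of frequency \<open>?c a\<close> is
    the conjugate character value at \<open>r\<close>, divided by the number of frequencies.\<close>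
  let ?f = "\<lambda>x. \<Sum>a\<in>residue_reps p w n. (chi (- (?c a * r)) / of_nat (p ^ n)) * psi (?c a) x"
  have eq: "?f x = indicator (cyl n r) x" if x: "x \<in> space M" for x
  proof -
    have "?f x = (\<Sum>a\<in>residue_reps p w n. chi (w powi (- int n) * a * (phi x - r))) / of_nat (p ^ n)"
      unfolding sum_divide_distrib using x
      by (intro sum.cong refl) (simp add: psi_def right_diff_distrib flip: chi_add)
    also have "\<dots> = indicator (cyl n r) x"
      using sum_chi_residue_reps[OF integers_diff[OF phi_integers[OF x] residue_reps_integers[OF r]], of n] x p_gt_1
      by (simp add: indicator_def mem_cyl)
    finally show ?thesis .
  qed
  have "?f \<in> L2_closed_span M system"
    by (intro L2_closed_span_base system_L2 lin_span_sum lin_span_cmult lin_span_base psi_mem_system)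
  then show ?thesis
    by (rule L2_closed_span_AE[OF _ L2_indicator[OF cyl_sets[OF r]] AE_I2 system_L2]) (rule eq)
qed

text \<open>Ultrametric balls are nested or disjoint, because every point of a ball is a centre of
  it. The empty set is adjoined for the disjoint case.\<close>

lemma cyl_Int_stable: "Int_stable (insert {} {cyl n r | n r. r \<in> residue_reps p w n})"
proof -
  have *: "cyl n r \<inter> cyl m s = {} \<or> cyl n r \<inter> cyl m s = cyl m s" if "n \<le> m" for n m r s
  proof (rule disjCI, rule ccontr)
    assume "cyl n r \<inter> cyl m s \<noteq> cyl m s" "cyl n r \<inter> cyl m s \<noteq> {}"
    then obtain x y where xy: "x \<in> cyl m s" "x \<notin> cyl n r" "y \<in> cyl n r" "y \<in> cyl m s" by blast
    have "N w ^ m \<le> N w ^ n" using that N_w by (intro power_decreasing) auto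
    then have "N (phi x - s) \<le> N w ^ n" "N (s - phi y) \<le> N w ^ n" "N (phi y - r) \<le> N w ^ n"
      using xy by (auto simp: mem_cyl N_minus_commute[of s])
    then have "N (phi x - r) \<le> N w ^ n" using N_triangle_le by blast
    with xy show False by (simp add: mem_cyl)
  qed
  have "cyl n r \<inter> cyl m s \<in> {{}, cyl n r, cyl m s}" for n m r s
    using *[of n m r s] *[of m n s r] by (cases "n \<le> m") (auto simp: Int_commute)
  then show ?thesis unfolding Int_stable_def by blast
qed

lemma sigma_cyl_closed_span:
  assumes "A \<in> sigma_sets (space M) (insert {} {cyl n r | n r. r \<in> residue_reps p w n})" (is "_ \<in> sigma_sets _ ?G")
  shows "A \<in> sets M \<and> (\<lambda>x. indicator A x) \<in> L2_closed_span M system"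
  using cyl_Int_stable _ assms
proof (rule sigma_sets_induct_disjoint)
  show "?G \<subseteq> Pow (space M)" by (auto simp: mem_cyl)
  show "A \<in> sets M \<and> (\<lambda>x. indicator A x) \<in> L2_closed_span M system" if "A \<in> ?G" for A
    using that L2_closed_span_base[OF system_L2 lin_span_0] by (auto intro: cyl_sets cyl_closed_span)
  show "{} \<in> sets M \<and> (\<lambda>x. indicator {} x) \<in> L2_closed_span M system"
    using L2_closed_span_base[OF system_L2 lin_span_0] by simp
next
  fix A assume A: "A \<in> sets M \<and> (\<lambda>x. indicator A x) \<in> L2_closed_span M system"
  \<comment> \<open>The only cylinder of level 0 is the whole space, so its indicator is available
    for complements.\<close>
  have "0 \<in> residue_reps p w 0" by (simp add: residue_reps_def)
  moreover have "cyl 0 0 = space M"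
    using phi_integers by (auto simp: mem_cyl mem_integers)
  ultimately have "(\<lambda>x. indicator (space M) x) \<in> L2_closed_span M system"
    using cyl_closed_span[of 0 0] by simp
  then have "(\<lambda>x. indicator (space M) x + - 1 * indicator A x) \<in> L2_closed_span M system"
    using A by (intro L2_closed_span_add system_L2 L2_closed_span_cmult) auto
  also have "(\<lambda>x. indicator (space M) x + - 1 * indicator A x) = (\<lambda>x. indicator (space M - A) x :: complex)"
    using A sets.sets_into_space[of A M] by (auto simp: indicator_def fun_eq_iff)
  finally show "space M - A \<in> sets M \<and> (\<lambda>x. indicator (space M - A) x) \<in> L2_closed_span M system"
    using A by auto
next
  fix A :: "nat \<Rightarrow> 'a set"
  assume disj: "disjoint_family A"
    and A: "\<And>i. A i \<in> sets M \<and> (\<lambda>x. indicator (A i) x) \<in> L2_closed_span M system"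
  let ?U = "\<Union>i. A i"
  \<comment> \<open>Finite partial unions: by disjointness their indicators are finite sums, and
    they converge to that of \<open>?U\<close> with squared difference at most 1.\<close>
  define V where "V n = (\<Union>i<n. A i)" for n
  let ?i = "\<lambda>A x. indicator A x :: complex"
  have U: "?U \<in> sets M" and V: "V n \<in> sets M" for n
    using A by (auto simp: V_def)
  have "(\<lambda>n. L2_dist2 M (?i ?U) (?i (V n))) \<longlonglongrightarrow> (LINT x|M. 0)"
    unfolding L2_dist2_def
  proof (rule integral_dominated_convergence[where w="\<lambda>_. 1"])
    show "AE x in M. (\<lambda>n. (cmod (?i ?U x - ?i (V n) x))\<^sup>2) \<longlonglongrightarrow> 0"
    proof (rule AE_I2)
      fix x
      have "(\<lambda>n. (cmod (?i ?U x - ?i (V n) x))\<^sup>2) \<longlonglongrightarrow> (cmod (?i ?U x - ?i ?U x))\<^sup>2"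
        unfolding V_def by (intro tendsto_intros LIMSEQ_indicator_UN)
      then show "(\<lambda>n. (cmod (?i ?U x - ?i (V n) x))\<^sup>2) \<longlonglongrightarrow> 0" by simp
    qed
    show "(\<lambda>x. (cmod (?i ?U x - ?i (V n) x))\<^sup>2) \<in> borel_measurable M" for n
      using U V by measurable
    show "AE x in M. norm ((cmod (?i ?U x - ?i (V n) x))\<^sup>2) \<le> 1" for n
      by (intro AE_I2) (auto simp: indicator_def)
    show "integrable M (\<lambda>_. 1 :: real)"
      by (rule integrable_const)
    show "(\<lambda>_. 0) \<in> borel_measurable M"
      by (rule measurable_const) simp
  qed
  then have lim: "\<forall>\<^sub>F n in sequentially. L2_dist2 M (?i ?U) (?i (V n)) < \<epsilon>" if "\<epsilon> > 0" for \<epsilon>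
    using that by (intro order_tendstoD) auto
  have s: "?i (V n) \<in> L2_closed_span M system" for n
  proof -
    have "?i (V n) = (\<lambda>x. \<Sum>i<n. ?i (A i) x)"
      unfolding V_def using disj
      by (intro ext indicator_UN_disjoint) (auto simp: disjoint_family_on_def)
    then show ?thesis
      using A by (simp only: L2_closed_span_sum[OF system_L2])
  qed
  have "?i ?U \<in> L2_closed_span M system"
  proof (rule L2_closed_span_limit[OF system_L2 L2_indicator[OF U]])
    fix \<epsilon> :: real assume "\<epsilon> > 0"
    then obtain n where "L2_dist2 M (?i ?U) (?i (V n)) < \<epsilon>"
      using lim[of \<epsilon>] by (auto simp: eventually_sequentially)
    with s show "\<exists>g\<in>L2_closed_span M system. L2_dist2 M (?i ?U) g < \<epsilon>" by blast
  qed
  with U show "?U \<in> sets M \<and> (\<lambda>x. indicator ?U x) \<in> L2_closed_span M system" by blast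
qed

theorem orthonormal_basis_system: "orthonormal_basis M system"
  unfolding orthonormal_basis_def
proof (intro conjI ballI allI impI system_L2 system_orthonormal)
  fix f and \<epsilon> :: real assume f: "f \<in> L2 M" and "\<epsilon> > 0"
  have "f \<in> L2_closed_span M system"
  proof (rule L2_closed_span_indicators[OF system_L2 _ f])
    fix A assume A: "A \<in> sets M"
    obtain B where B: "B \<in> sigma_sets (space M) {cyl n r | n r. r \<in> residue_reps p w n}"
      "AE x in M. x \<in> A \<longleftrightarrow> x \<in> B"
      using cyl_generate[OF A] by blast
    have "B \<in> sigma_sets (space M) (insert {} {cyl n r | n r. r \<in> residue_reps p w n})"
      by (rule subsetD[OF sigma_sets_mono' B(1)]) (rule subset_insertI)
    then have "(\<lambda>x. indicator B x) \<in> L2_closed_span M system"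
      using sigma_cyl_closed_span by blast
    moreover have "AE x in M. indicator B x = (indicator A x :: complex)"
      using B(2) by (auto simp: indicator_def)
    ultimately show "(\<lambda>x. indicator A x) \<in> L2_closed_span M system"
      using L2_closed_span_AE[OF _ L2_indicator[OF A] _ system_L2] by blast
  qed
  \<comment> \<open>\<open>L2_norm\<close> is a square root, so the squared distance is made smaller
    than \<open>\<epsilon>\<^sup>2\<close>.\<close>
  then obtain g where g: "g \<in> lin_span system" "L2_dist2 M f g < \<epsilon>\<^sup>2"
    unfolding L2_closed_span_def using \<open>\<epsilon> > 0\<close> by (auto dest!: spec[of _ "\<epsilon>\<^sup>2"])
  then obtain F c where F: "finite F" "F \<subseteq> system" "g = (\<lambda>x. \<Sum>b\<in>F. c b * b x)"
    unfolding lin_span_def by blast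
  have "L2_norm M (\<lambda>x. f x - (\<Sum>b\<in>F. c b * b x)) < \<epsilon>"
    using g(2) \<open>\<epsilon> > 0\<close> unfolding F L2_norm_def L2_dist2_def by (intro real_less_lsqrt) auto
  with F show "\<exists>F c. finite F \<and> F \<subseteq> system \<and> L2_norm M (\<lambda>x. f x - (\<Sum>b\<in>F. c b * b x)) < \<epsilon>"
    by blast
qed

end

section \<open>Haar measure and the base-\<open>p\<close> coding of the unit interval\<close>

lemma (in finite_measure) measure_fibres_sum:
  assumes "finite R" "\<And>r. r \<in> R \<Longrightarrow> C r \<in> sets M" "\<And>x. x \<in> space M \<Longrightarrow> \<exists>!r. r \<in> R \<and> x \<in> C r"
  shows "(\<Sum>r\<in>R. measure M (C r)) = measure M (space M)"
proof -
  have "disjoint_family_on C R"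
    unfolding disjoint_family_on_def
    using assms(3) sets.sets_into_space[OF assms(2)] by blast
  moreover have "(\<Union>r\<in>R. C r) = space M"
    using assms(3) sets.sets_into_space[OF assms(2)] by blast
  ultimately show ?thesis
    using finite_measure_finite_Union[of R C] assms(1,2) by (simp add: image_subset_iff)
qed

context digit_field
begin

text \<open>By \<open>small\<close>, around each point the cylinders shrink in the metric of the
  source, so an open set is the union of the cylinders inside it. Each level is finite, so the union
  is countable. The cylinders themselves may fail to be open, as happens in the unit
  interval.\<close>

lemma sigma_sets_cylinders_borel:
  fixes S :: "'b::metric_space set" and phi :: "'b \<Rightarrow> 'k"
  assumes phi: "\<And>x. x \<in> S \<Longrightarrow> phi x \<in> integers"
    and small: "\<And>x e. x \<in> S \<Longrightarrow> e > 0 \<Longrightarrow> \<exists>n. \<forall>y\<in>S. N (phi y - phi x) \<le> N w ^ n \<longrightarrow> dist x y < e"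
    and A: "A \<in> sets borel"
  shows "A \<inter> S \<in> sigma_sets S {{x\<in>S. dist (phi x) r \<le> dist w 0 ^ n} | n r. r \<in> residue_reps p w n}"
    (is "_ \<in> sigma_sets S ?G")
proof -
  have "?G = (\<Union>n. (\<lambda>r. {x\<in>S. dist (phi x) r \<le> dist w 0 ^ n}) ` residue_reps p w n)"
    by blast
  also have "countable \<dots>"
    by (intro countable_UN countableI_type countable_finite finite_imageI finite_residue_reps)
  finally have G: "countable ?G" .
  have "A \<in> sigma_sets UNIV {U. open U}"
    using A by (simp add: borel_def)
  then show ?thesis
  proof induction
    case (Basic U)
    have "U \<inter> S = \<Union>{C\<in>?G. C \<subseteq> U}"
    proof
      show "U \<inter> S \<subseteq> \<Union>{C\<in>?G. C \<subseteq> U}"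
      proof
        fix x assume x: "x \<in> U \<inter> S"
        then obtain e where e: "e > 0" "ball x e \<subseteq> U" using Basic by (auto elim: openE)
        then obtain n where n: "\<forall>y\<in>S. N (phi y - phi x) \<le> N w ^ n \<longrightarrow> dist x y < e"
          using small[of x e] x by auto
        obtain r where r: "r \<in> residue_reps p w n" "N (phi x - r) \<le> N w ^ n"
          using residue_reps_exists phi x by blast
        have "y \<in> U" if "y \<in> S" "N (phi y - r) \<le> N w ^ n" for y
        proof -
          have "N (phi y - phi x) \<le> N w ^ n"
            using N_triangle_le[OF that(2)] r(2) N_minus_commute[of r] by simp
          with n that e show ?thesis by auto
        qed
        then show "x \<in> \<Union>{C\<in>?G. C \<subseteq> U}"
          using r x by (intro UnionI[of "{y\<in>S. dist (phi y) r \<le> dist w 0 ^ n}"])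
            (auto simp: dist_eq_N intro!: exI[of _ n] exI[of _ r])
      qed
    qed auto
    moreover have "countable {C\<in>?G. C \<subseteq> U}"
      using G by (rule countable_subset[rotated]) blast
    ultimately show ?case
      by (simp only:) (rule sigma_sets_UNION, auto intro: sigma_sets.Basic)
  next
    case (Compl A)
    have "(UNIV - A) \<inter> S = S - (A \<inter> S)" by blast
    then show ?case using sigma_sets.Compl[OF Compl.IH] by simp
  next
    case (Union A)
    have "(\<Union>i. A i) \<inter> S = (\<Union>i. A i \<inter> S)" by blast
    then show ?case using sigma_sets.Union[of "\<lambda>i. A i \<inter> S", OF Union.IH] by simp
  qed (simp add: sigma_sets.Empty)
qed

text \<open>Each point lies in the cylinder of its representative and in no other. The sum then
  fixes the individual measures once they are known to be equal (Haar) or bounded by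
  \<open>p^(-n)\<close> (Lebesgue).\<close>

lemma sum_measure_cylinders:
  fixes M :: "'b measure" and phi :: "'b \<Rightarrow> 'k"
  assumes "finite_measure M"
    and phi: "\<And>x. x \<in> space M \<Longrightarrow> phi x \<in> integers"
    and sets: "\<And>r. r \<in> residue_reps p w n \<Longrightarrow> cylinder M phi w n r \<in> sets M"
  shows "(\<Sum>r\<in>residue_reps p w n. measure M (cylinder M phi w n r)) = measure M (space M)"
proof (rule finite_measure.measure_fibres_sum[OF assms(1) finite_residue_reps sets])
  fix x assume x: "x \<in> space M"
  show "\<exists>!r. r \<in> residue_reps p w n \<and> x \<in> cylinder M phi w n r"
  proof (rule ex1I[of _ "rep n (phi x)"])
    show "rep n (phi x) \<in> residue_reps p w n \<and> x \<in> cylinder M phi w n (rep n (phi x))"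
      using rep[OF phi[OF x]] x by (simp add: cylinder_def dist_eq_N)
    show "r = rep n (phi x)" if "r \<in> residue_reps p w n \<and> x \<in> cylinder M phi w n r" for r
      using that rep_eqI[OF phi[OF x], of r n] by (simp add: cylinder_def dist_eq_N)
  qed
qed

end

section \<open>The ring of integers with Haar measure\<close>

context digit_character
begin

theorem orthonormal_basis_haar:
  fixes \<mu> :: "'k measure"
  assumes "normalized_haar \<mu>"
  shows "orthonormal_basis (restrict_space \<mu> integers) (character_group p w chi)"
proof -
  define M where "M = restrict_space \<mu> integers"
  have sets_mu: "sets \<mu> = sets borel" and one: "emeasure \<mu> integers = 1"
    and shift: "\<And>a A. A \<in> sets borel \<Longrightarrow> emeasure \<mu> ((+) a ` A) = emeasure \<mu> A"
    using assms by (auto simp: normalized_haar_def)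
  have "space \<mu> = UNIV"
    using sets_eq_imp_space_eq[OF sets_mu] by simp
  then have space_M: "space M = integers"
    by (simp add: M_def space_restrict_space)
  have I: "integers \<in> sets (borel :: 'k measure)"
    by (simp add: integers_def)
  have sets_M: "A \<in> sets M \<longleftrightarrow> A \<in> sets borel \<and> A \<subseteq> integers" for A
    using I by (simp add: M_def sets_restrict_space_iff sets_mu conj_commute)
  have emeasure_M: "emeasure M A = emeasure \<mu> A" if "A \<subseteq> integers" for A
    unfolding M_def using I that by (intro emeasure_restrict_space) (simp_all add: sets_mu \<open>space \<mu> = UNIV\<close>)
  interpret finite_measure M
    by (rule finite_measureI) (simp add: space_M emeasure_M one)
  define cyl where "cyl = cylinder M (\<lambda>x. x) w"
  have cyl_def': "cyl n r = {x\<in>space M. dist x r \<le> dist w 0 ^ n}" for n r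
    by (simp add: cyl_def cylinder_def)
  have cyl: "cyl n r \<in> sets borel" "cyl n r \<subseteq> integers" for n r
  proof -
    have "cyl n r = integers \<inter> cball r (dist w 0 ^ n)"
      by (auto simp: cyl_def' space_M dist_commute)
    with I show "cyl n r \<in> sets borel" "cyl n r \<subseteq> integers" by auto
  qed
  have cyl_eq: "cyl n r = (+) r ` cball 0 (dist w 0 ^ n)" if "r \<in> integers" for n r
  proof
    show "cyl n r \<subseteq> (+) r ` cball 0 (dist w 0 ^ n)"
    proof
      fix x assume "x \<in> cyl n r"
      then have "x = r + (x - r)" "x - r \<in> cball 0 (dist w 0 ^ n)"
        by (simp_all add: cyl_def' dist_eq_N N_minus_commute[of r])
      then show "x \<in> (+) r ` cball 0 (dist w 0 ^ n)" by blast
    qed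
    show "(+) r ` cball 0 (dist w 0 ^ n) \<subseteq> cyl n r"
    proof
      fix x assume "x \<in> (+) r ` cball 0 (dist w 0 ^ n)"
      then obtain y where y: "x = r + y" "N y \<le> N w ^ n"
        by (auto simp: dist_eq_N)
      \<comment> \<open>With radius at most 1, a ball around an integer stays in the ring of
        integers, so intersecting with \<open>space M\<close> removes nothing from the
        translate.\<close>
      moreover have "N w ^ n \<le> 1" using N_w by (simp add: power_le_one)
      ultimately have "y \<in> integers" by (simp add: mem_integers)
      with y that show "x \<in> cyl n r"
        by (simp add: cyl_def' space_M integers_add dist_eq_N)
    qed
  qed
  have measure_cyl: "measure M (cyl n r) = 1 / real p ^ n" if r: "r \<in> residue_reps p w n" for n r
  proof -
    have *: "measure M (cyl n s) = measure \<mu> (cball 0 (dist w 0 ^ n))" if "s \<in> residue_reps p w n" for s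
      using shift[of "cball 0 (dist w 0 ^ n)" s] cyl_eq[OF residue_reps_integers[OF that], of n]
        emeasure_M[OF cyl(2), of n s]
      by (simp add: measure_def)
    have "(\<Sum>s\<in>residue_reps p w n. measure M (cyl n s)) = measure M (space M)"
      unfolding cyl_def using cyl[unfolded cyl_def]
      by (intro sum_measure_cylinders) (simp_all add: space_M sets_M finite_measure_axioms)
    also have "\<dots> = 1" by (simp add: measure_def space_M emeasure_M one)
    \<comment> \<open>All \<open>p ^ n\<close> summands equal the measure of the ball around
      0.\<close>
    finally have "real p ^ n * measure \<mu> (cball 0 (dist w 0 ^ n)) = 1"
      using * by (simp add: card_residue_reps)
    with *[OF r] p_gt_1 show ?thesis by (simp add: field_simps)
  qed
  interpret digit_space p w chi M "\<lambda>x. x"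
  proof unfold_locales
    show "cylinder M (\<lambda>x. x) w n r \<in> sets M" for n r
      using cyl[of n r] by (simp add: cyl_def sets_M)
    show "measure M (cylinder M (\<lambda>x. x) w n r) = 1 / real p ^ n"
      if "r \<in> residue_reps p w n" for n r
      using measure_cyl[OF that] by (simp add: cyl_def)
    fix A assume A: "A \<in> sets M"
    have "A \<inter> space M \<in> sigma_sets (space M) {cylinder M (\<lambda>x. x) w n r |n r. r \<in> residue_reps p w n}"
    unfolding cylinder_def
    proof (rule sigma_sets_cylinders_borel)
      fix x :: 'k and e :: real assume "e > 0"
      then obtain n where "N w ^ n < e"
        using order_tendstoD(2)[OF N_w_power_tendsto_0] by (auto simp: eventually_sequentially)
      then show "\<exists>n. \<forall>y\<in>space M. N (y - x) \<le> N w ^ n \<longrightarrow> dist x y < e"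
        by (intro exI[of _ n]) (auto simp: dist_eq_N N_minus_commute[of x])
    qed (use A in \<open>simp_all add: space_M sets_M\<close>)
    moreover have "A \<inter> space M = A"
      using A by (auto simp: sets_M space_M)
    ultimately show "\<exists>B\<in>sigma_sets (space M) {cylinder M (\<lambda>x. x) w n r |n r. r \<in> residue_reps p w n}.
        AE x in M. (x \<in> A) = (x \<in> B)"
      by (intro bexI[of _ A]) auto
  qed (simp add: space_M)
  have "system = character_group p w chi"
    by (simp add: system_def character_group_def psi_def space_M)
  with orthonormal_basis_system show ?thesis by (simp add: M_def)
qed

end

section \<open>Greedy digits of real numbers\<close>

lemma greedy_rem_Suc: "greedy_rem p x (Suc i) = real p * greedy_rem p x i - real (greedy_digit p x i)"
  by (simp add: greedy_digit_def)

lemma greedy_digit_less: "0 < p \<Longrightarrow> greedy_digit p x i < p"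
  by (simp add: greedy_digit_def min_less_iff_disj)

text \<open>The interval is closed at 1 on account of the cap \<open>p - 1\<close>: when it is
  active, \<open>real p * greedy_rem p x i\<close> is exactly \<open>p\<close> and the next
  remainder is again 1. This is the case \<open>x = 1\<close>.\<close>

lemma greedy_rem_bounds:
  assumes "0 < p" "x \<in> {0..1}"
  shows "greedy_rem p x i \<in> {0..1}"
proof (induction i)
  case (Suc i)
  let ?y = "real p * greedy_rem p x i"
  have y: "0 \<le> ?y" "?y \<le> real p"
    using Suc assms(1) mult_left_mono[of "greedy_rem p x i" 1 "real p"] by auto
  have fl: "real (nat \<lfloor>?y\<rfloor>) \<le> ?y" "?y < real (nat \<lfloor>?y\<rfloor>) + 1"
    using y(1) by linarith+
  show ?case
  proof (cases "nat \<lfloor>?y\<rfloor> \<le> p - 1")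
    case True
    then have "greedy_rem p x (Suc i) = ?y - real (nat \<lfloor>?y\<rfloor>)" by simp
    then show ?thesis using fl by (simp only: atLeastAtMost_iff) linarith
  next
    case False
    then have "greedy_rem p x (Suc i) = ?y - (real p - 1)" "real p \<le> real (nat \<lfloor>?y\<rfloor>)"
      using assms(1) by (auto simp: of_nat_diff)
    then show ?thesis using fl y by (simp only: atLeastAtMost_iff) linarith
  qed
qed (use assms in simp)

lemma greedy_expansion:
  assumes "0 < p"
  shows "real p ^ n * x = (\<Sum>i<n. real (greedy_digit p x i) * real p ^ (n - Suc i)) + greedy_rem p x n"
proof (induction n)
  case (Suc n)
  have "real p ^ Suc n * x = real p * (real p ^ n * x)" by simp
  also have "\<dots> = (\<Sum>i<n. real (greedy_digit p x i) * real p ^ (Suc n - Suc i))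
      + real p * greedy_rem p x n"
    unfolding Suc distrib_left sum_distrib_left
    by (intro arg_cong2[where f="(+)"] sum.cong refl) (simp add: Suc_diff_Suc flip: power_Suc)
  also have "\<dots> = (\<Sum>i<Suc n. real (greedy_digit p x i) * real p ^ (Suc n - Suc i))
      + greedy_rem p x (Suc n)"
    by (simp add: greedy_rem_Suc del: greedy_rem.simps)
  finally show ?case .
qed simp

text \<open>In \<open>greedy_expansion\<close> the digit sums cancel, which leaves the difference of
  two remainders from the unit interval.\<close>

lemma greedy_digits_eq_imp_close:
  assumes "0 < p" "x \<in> {0..1}" "y \<in> {0..1}" "\<And>i. i < n \<Longrightarrow> greedy_digit p x i = greedy_digit p y i"
  shows "\<bar>x - y\<bar> \<le> 1 / real p ^ n"
proof -
  have "real p ^ n * (x - y) = greedy_rem p x n - greedy_rem p y n"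
    unfolding right_diff_distrib greedy_expansion[OF assms(1)] using assms(4) by simp
  moreover have "\<bar>greedy_rem p x n - greedy_rem p y n\<bar> \<le> 1"
    using greedy_rem_bounds[OF assms(1,2), of n] greedy_rem_bounds[OF assms(1,3), of n] by auto
  ultimately have "\<bar>real p ^ n * (x - y)\<bar> \<le> 1" by simp
  then have "real p ^ n * \<bar>x - y\<bar> \<le> 1" by (simp only: abs_mult) simp
  with assms(1) show ?thesis by (simp add: field_simps)
qed

lemma measurable_greedy_digit [measurable]: "(\<lambda>x. greedy_digit p x i) \<in> measurable borel (count_space UNIV)"
proof -
  have [measurable]: "(\<lambda>x. greedy_rem p x i) \<in> borel_measurable borel"
  proof (induction i)
    case (Suc i)
    note Suc[measurable]
    show ?case by simp measurable
  qed simp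
  show ?thesis unfolding greedy_digit_def by measurable
qed

text \<open>Such a set fits into the interval of length \<open>d\<close> that starts at its infimum.
  Thus digit cylinders are bounded by their diameter alone.\<close>

lemma measure_le_diameter:
  fixes C :: "real set"
  assumes "C \<in> sets lebesgue" "\<And>x y. x \<in> C \<Longrightarrow> y \<in> C \<Longrightarrow> \<bar>x - y\<bar> \<le> d" "0 \<le> d"
  shows "measure lebesgue C \<le> d"
proof (cases "C = {}")
  case False
  then obtain c where c: "c \<in> C" by blast
  have "bdd_below C" using assms(2)[OF c] by (intro bdd_belowI[of _ "c - d"]) (auto simp: abs_le_iff algebra_simps)
  have "C \<subseteq> {Inf C..Inf C + d}"
  proof
    fix x assume x: "x \<in> C"
    have "x - d \<le> Inf C"
      using False assms(2)[OF x] by (intro cInf_greatest) (auto simp: abs_le_iff algebra_simps)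
    moreover have "Inf C \<le> x"
      using \<open>bdd_below C\<close> x by (intro cInf_lower)
    ultimately show "x \<in> {Inf C..Inf C + d}" by auto
  qed
  then have "measure lebesgue C \<le> measure lebesgue {Inf C..Inf C + d}"
    using assms(1) by (intro measure_mono_fmeasurable) auto
  then show ?thesis using assms(3) by simp
qed (use assms in simp)

section \<open>The unit interval with Lebesgue measure\<close>

context digit_character
begin

lemma
  shows rho_integers: "rho p w x \<in> integers"
    and rho_digit_sum: "N (rho p w x - digit_sum (greedy_digit p x) n) \<le> N w ^ n"
proof -
  have "summable (\<lambda>i. of_nat (greedy_digit p x i) * w ^ i)"
    using digit_series[of "greedy_digit p x"] greedy_digit_less p_gt_1 by (auto simp: summable_def)
  then have "(\<lambda>i. of_nat (greedy_digit p x i) * w ^ i) sums rho p w x"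
    unfolding rho_def by (rule summable_sums)
  then show *: "N (rho p w x - digit_sum (greedy_digit p x) n) \<le> N w ^ n" for n
    by (rule digit_series_tail)
  \<comment> \<open>With no digits removed, the tail estimate bounds \<open>rho p w x\<close> itself
    by 1.\<close>
  from *[of 0] show "rho p w x \<in> integers"
    by (simp add: digit_sum_def mem_integers)
qed

text \<open>Turns a ball in the field into a condition on greedy digits; uniqueness of digits modulo
  \<open>w ^ n\<close> gives the forward direction.\<close>

lemma rho_close_iff:
  assumes "\<And>i. i < n \<Longrightarrow> a i < p"
  shows "N (rho p w x - digit_sum a n) \<le> N w ^ n \<longleftrightarrow> (\<forall>i<n. greedy_digit p x i = a i)"
proof
  assume "N (rho p w x - digit_sum a n) \<le> N w ^ n"
  then have "N (digit_sum (greedy_digit p x) n - digit_sum a n) \<le> N w ^ n"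
    using N_triangle_le[of "digit_sum (greedy_digit p x) n" "rho p w x"] rho_digit_sum[of x n]
    by (simp add: N_minus_commute[of "digit_sum (greedy_digit p x) n"])
  then show "\<forall>i<n. greedy_digit p x i = a i"
    using assms greedy_digit_less[of p x] p_gt_1
    by (intro allI impI digit_sum_unique[of n "greedy_digit p x" a]) auto
next
  assume "\<forall>i<n. greedy_digit p x i = a i"
  then have "digit_sum a n = digit_sum (greedy_digit p x) n"
    by (intro digit_sum_cong) simp
  with rho_digit_sum[of x n] show "N (rho p w x - digit_sum a n) \<le> N w ^ n" by simp
qed

theorem orthonormal_basis_omega:
  "orthonormal_basis (lebesgue_on {0..1}) (omega_system p w chi)"
proof -
  define M where "M = lebesgue_on {0..1::real}"
  have space_M: "space M = {0..1}"
    by (simp add: M_def space_restrict_space)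
  have sets_M: "A \<in> sets M \<longleftrightarrow> A \<in> sets lebesgue \<and> A \<subseteq> {0..1}" for A
    by (simp add: M_def sets_restrict_space_iff conj_commute)
  have measure_M: "measure M A = measure lebesgue A" if "A \<subseteq> {0..1}" for A
    unfolding M_def using that by (intro measure_restrict_space) auto
  interpret finite_measure M
    unfolding M_def by (intro finite_measureI) (simp add: emeasure_restrict_space space_restrict_space)
  have cyl_eq: "cylinder M (rho p w) w n (digit_sum a n) = {x\<in>{0..1}. \<forall>i<n. greedy_digit p x i = a i}"
    if "\<And>i. i < n \<Longrightarrow> a i < p" for n a
    using rho_close_iff[OF that] by (auto simp: cylinder_def space_M dist_eq_N)
  have cyl: "cylinder M (rho p w) w n r \<in> sets M" "measure M (cylinder M (rho p w) w n r) \<le> 1 / real p ^ n"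
    if "r \<in> residue_reps p w n" for n r
  proof -
    obtain a where a: "r = digit_sum a n" "\<And>i. i < n \<Longrightarrow> a i < p"
      using \<open>r \<in> residue_reps p w n\<close> by (auto simp: residue_reps_eq)
    let ?C = "{x\<in>{0..1}. \<forall>i<n. greedy_digit p x i = a i}"
    have C: "cylinder M (rho p w) w n r = ?C"
      unfolding a(1) by (rule cyl_eq) (rule a(2))
    have "{x \<in> space borel. x \<in> {0..1} \<and> (\<forall>i\<in>{..<n}. greedy_digit p x i = a i)} \<in> sets borel"
      by measurable
    then have L: "?C \<in> sets lebesgue" by (simp add: sets_completionI_sets Ball_def)
    then show "cylinder M (rho p w) w n r \<in> sets M" by (auto simp: C sets_M)
    have "measure lebesgue ?C \<le> 1 / real p ^ n"
      using L p_gt_1 by (intro measure_le_diameter greedy_digits_eq_imp_close) auto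
    then show "measure M (cylinder M (rho p w) w n r) \<le> 1 / real p ^ n"
      by (subst C, subst measure_M) auto
  qed
  have "(\<Sum>r\<in>residue_reps p w n. measure M (cylinder M (rho p w) w n r)) = (\<Sum>r\<in>residue_reps p w n. 1 / real p ^ n)" for n
  proof -
    have "(\<Sum>r\<in>residue_reps p w n. measure M (cylinder M (rho p w) w n r)) = measure M (space M)"
      using cyl(1) rho_integers by (intro sum_measure_cylinders) (simp_all add: space_M finite_measure_axioms)
    also have "\<dots> = 1" by (simp add: space_M measure_M)
    also have "\<dots> = (\<Sum>r\<in>residue_reps p w n. 1 / real p ^ n)"
      using p_gt_1 by (simp add: card_residue_reps)
    finally show ?thesis .
  qed
  \<comment> \<open>Summands that are at most \<open>p^(-n)\<close> and add up to the sum of these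
    bounds must all attain them.\<close>
  from sum_mono_inv[OF this cyl(2) _ finite_residue_reps]
  have measure_cyl: "measure M (cylinder M (rho p w) w n r) = 1 / real p ^ n"
    if "r \<in> residue_reps p w n" for n r
    using that by blast
  interpret digit_space p w chi M "rho p w"
  proof unfold_locales
    fix A assume A: "A \<in> sets M"
    then have "A \<in> sets lebesgue" "A \<subseteq> {0..1}" by (simp_all add: sets_M)
    \<comment> \<open>A Lebesgue set is a Borel set up to part of a Borel null set; the cylinders
      only have to generate the Borel part \<open>S\<close>.\<close>
    then obtain S Z Z' where S: "A = S \<union> Z" "Z \<subseteq> Z'" "Z' \<in> null_sets lborel" "S \<in> sets lborel"
      by (auto elim: sets_completionE)
    have gen: "S \<inter> space M \<in> sigma_sets (space M) {cylinder M (rho p w) w n r |n r. r \<in> residue_reps p w n}"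
      unfolding cylinder_def
    proof (rule sigma_sets_cylinders_borel)
      fix x e :: real assume x: "x \<in> space M" and "e > 0"
      have "(\<lambda>n. 1 / real p ^ n) \<longlonglongrightarrow> 0"
        using p_gt_1 LIMSEQ_power_zero[of "1 / real p"] by (simp add: power_one_over)
      from order_tendstoD(2)[OF this \<open>e > 0\<close>] obtain n where n: "1 / real p ^ n < e"
        by (auto simp: eventually_sequentially)
      have "dist x y < e" if y: "y \<in> space M" "N (rho p w y - rho p w x) \<le> N w ^ n" for y
      proof -
        have "N (rho p w y - digit_sum (greedy_digit p x) n) \<le> N w ^ n"
          by (rule N_triangle_le[OF y(2)]) (use x rho_digit_sum in \<open>simp add: space_M\<close>)
        then have "\<forall>i<n. greedy_digit p y i = greedy_digit p x i"
          using rho_close_iff[of n "greedy_digit p x"] greedy_digit_less p_gt_1 by simp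
        then have "\<bar>x - y\<bar> \<le> 1 / real p ^ n"
          using x y(1) p_gt_1 by (intro greedy_digits_eq_imp_close) (auto simp: space_M)
        with n show ?thesis by (simp add: dist_real_def)
      qed
      then show "\<exists>n. \<forall>y\<in>space M. N (rho p w y - rho p w x) \<le> N w ^ n \<longrightarrow> dist x y < e" by blast
    qed (use S in \<open>simp_all add: space_M rho_integers\<close>)
    have "AE x in lebesgue. x \<notin> Z'"
      using S(3) by (intro AE_not_in) (simp add: null_sets_completionI)
    then have "AE x in M. x \<notin> Z'"
      unfolding M_def by (subst AE_restrict_space_iff) auto
    then have "AE x in M. (x \<in> A) = (x \<in> S \<inter> space M)"
      by (rule AE_mp) (use S in \<open>auto intro!: AE_I2\<close>)
    with gen show "\<exists>B\<in>sigma_sets (space M) {cylinder M (rho p w) w n r |n r. r \<in> residue_reps p w n}.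
        AE x in M. (x \<in> A) = (x \<in> B)" by blast
  qed (simp_all add: space_M rho_integers cyl(1) measure_cyl)
  have "system = omega_system p w chi"
    by (simp add: system_def omega_system_def omega_def psi_def space_M) blast
  with orthonormal_basis_system show ?thesis by (simp add: M_def)
qed

end

section \<open>Laurent series over the prime field\<close>

lemma cis_2pi_cong: "t - s \<in> \<int> \<Longrightarrow> cis (2 * pi * t) = cis (2 * pi * s)"
proof -
  assume "t - s \<in> \<int>"
  then have "cis (2 * pi * (t - s)) = 1" by (rule cis_multiple_2pi)
  then have "cis (2 * pi * s) = cis (2 * pi * s) * cis (2 * pi * (t - s))" by simp
  also have "\<dots> = cis (2 * pi * t)" by (simp only: cis_mult flip: distrib_left) simp
  finally show ?thesis by simp
qed

lemma cis_2pi_over_neq_1: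
  assumes "1 < (p::nat)" shows "cis (2 * pi * (1 / real p)) \<noteq> 1"
  using complex_root_unity_eq_1[of p 1] assms by (simp add: cis_conv_exp mult_ac)

lemma dist_fls_0: "dist x (0 :: 'a::group_add fls) = (if x = 0 then 0 else 2 powi (- fls_subdegree x))"
  by (auto simp: dist_fls_def power_int_def power_one_over inverse_eq_divide)

lemma two_powi_le_iff: "(2::real) powi a \<le> 2 powi b \<longleftrightarrow> a \<le> b"
  using power_int_strict_increasing[of b a "2::real"] power_int_increasing[of a b "2::real"]
  by (cases "a \<le> b") auto

text \<open>Describing balls by vanishing coefficients reduces the metric axioms of
  \<open>digit_field\<close> to comparisons of coefficients.\<close>

lemma dist_fls_0_le_iff: "dist x (0 :: 'a::group_add fls) \<le> 2 powi (- n) \<longleftrightarrow> (\<forall>k<n. fls_nth x k = 0)"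
proof (cases "x = 0")
  case False
  have "(2::real) powi (- fls_subdegree x) \<le> 2 powi (- n) \<longleftrightarrow> n \<le> fls_subdegree x"
    by (simp add: two_powi_le_iff)
  also have "\<dots> \<longleftrightarrow> (\<forall>k<n. fls_nth x k = 0)"
    using False by (metis fls_eq0_below_subdegree fls_subdegree_geI order_less_le_trans)
  finally show ?thesis using False by (simp add: dist_fls_0)
qed (simp add: dist_fls_0)

lemma fls_integers_iff: "x \<in> (integers :: 'a::field fls set) \<longleftrightarrow> (\<forall>k<0. fls_nth x k = 0)"
  using dist_fls_0_le_iff[of x 0] by (simp add: integers_def dist_commute)

lemma digit_field_fls: "digit_field CARD('p) (fls_X :: 'p::prime_card mod_ring fls)"
proof
  let ?p = "CARD('p)"
  fix x y :: "'p mod_ring fls"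
  show "1 < ?p" using prime_gt_1_nat[OF prime_card[where 'a='p]] .
  show "dist x y = dist (x - y) 0" by (simp add: dist_fls_def)
  show "dist (x * y) 0 = dist x 0 * dist y 0"
    by (auto simp: dist_fls_0 power_int_diff power_int_minus divide_inverse)
  \<comment> \<open>Both series lie in the ball of radius \<open>dist v 0\<close>, which is a
    vanishing condition and hence closed under addition.\<close>
  have *: "dist (u + v) 0 \<le> dist v 0" if "dist u 0 \<le> dist v 0" for u v :: "'p mod_ring fls"
  proof (cases "v = 0")
    case False
    then have v: "dist v 0 = 2 powi (- fls_subdegree v)" by (simp add: dist_fls_0)
    have "dist v 0 \<le> 2 powi (- fls_subdegree v)" by (simp add: v)
    with that show ?thesis unfolding v by (simp add: dist_fls_0_le_iff)
  qed (use that in simp)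
  show "dist (x + y) 0 \<le> max (dist x 0) (dist y 0)"
    using *[of x y] *[of y x] by (cases "dist x 0 \<le> dist y 0") (auto simp: add.commute)
  have w: "dist (fls_X :: 'p mod_ring fls) 0 = 1 / 2"
    by (simp add: dist_fls_0 power_int_minus)
  then show "0 < dist (fls_X :: 'p mod_ring fls) 0" "dist (fls_X :: 'p mod_ring fls) 0 < 1" by simp_all
  show "dist x 0 \<le> dist (fls_X :: 'p mod_ring fls) 0" if "dist x 0 < 1"
  proof (cases "x = 0")
    case False
    then have "(2::real) powi (- fls_subdegree x) < 2 powi 0" using that by (simp add: dist_fls_0)
    then have "fls_subdegree x > 0" using two_powi_le_iff[of 0 "- fls_subdegree x"] by auto
    then have "(2::real) powi (- fls_subdegree x) \<le> 2 powi (- 1)" by (simp only: two_powi_le_iff)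
    then show ?thesis using False by (simp add: w dist_fls_0 power_int_minus)
  qed simp
  show "dist (of_nat d) (0 :: 'p mod_ring fls) = 1" if "0 < d" "d < ?p" for d
  proof -
    have "of_nat d \<noteq> (0 :: 'p mod_ring)"
      using of_nat_0_mod_ring_dvd[of d, where 'a='p] that nat_dvd_not_less by blast
    then show ?thesis by (simp add: fls_of_nat dist_fls_0)
  qed
  show "\<exists>d<?p. dist (x - of_nat d) 0 < 1" if "dist x 0 \<le> 1"
  proof -
    obtain d where d: "d < ?p" "fls_nth x 0 = of_nat d" using surj_of_nat_mod_ring by blast
    have "\<forall>k<0. fls_nth x k = 0" using that dist_fls_0_le_iff[of x 0] by simp
    then have "\<forall>k<1. fls_nth (x - of_nat d) k = 0" using d by (auto simp: fls_of_nat_nth)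
    then have "dist (x - of_nat d) 0 \<le> 2 powi (- 1)" by (rule dist_fls_0_le_iff[THEN iffD2])
    then have "dist (x - of_nat d) 0 < 1" by (simp add: power_int_minus)
    with d show ?thesis by blast
  qed
  show "\<exists>s. (\<lambda>i. of_nat (a i) * fls_X ^ i :: 'p mod_ring fls) sums s" if "\<And>i. a i < ?p" for a :: "nat \<Rightarrow> nat"
  proof
    \<comment> \<open>The limit is the power series whose coefficients are the given digits.\<close>
    let ?s = "fps_to_fls (Abs_fps (\<lambda>i. of_nat (a i))) :: 'p mod_ring fls"
    have nth: "fls_nth (\<Sum>i<n. of_nat (a i) * fls_X ^ i) k
        = (if 0 \<le> k \<and> k < int n then of_nat (a (nat k)) else (0 :: 'p mod_ring))" for n k
      by (induction n) (auto simp: fls_of_nat less_Suc_eq)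
    have "dist (\<Sum>i<n. of_nat (a i) * fls_X ^ i) ?s \<le> (1 / 2) ^ n" for n
    proof -
      have "dist (\<Sum>i<n. of_nat (a i) * fls_X ^ i) ?s = dist ((\<Sum>i<n. of_nat (a i) * fls_X ^ i) - ?s) 0"
        by (simp add: dist_fls_def)
      also have "\<dots> \<le> 2 powi (- int n)"
        unfolding dist_fls_0_le_iff by (auto simp: nth)
      finally show ?thesis by (simp add: power_int_minus power_one_over inverse_eq_divide)
    qed
    then have "(\<lambda>n. dist (\<Sum>i<n. of_nat (a i) * fls_X ^ i) ?s) \<longlonglongrightarrow> 0"
      by (intro tendsto_sandwich[OF _ _ tendsto_const LIMSEQ_power_zero[of "1 / 2 :: real"]]) auto
    then show "(\<lambda>i. of_nat (a i) * fls_X ^ i :: 'p mod_ring fls) sums ?s"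
      unfolding sums_def by (rule tendsto_dist_iff[THEN iffD2])
  qed
qed

lemma laurent_char_cis:
  "laurent_char (x :: 'p::prime_card mod_ring fls) = cis (2 * pi * (of_int (to_int_mod_ring (fls_nth x (- 1))) / real CARD('p)))"
  by (simp add: laurent_char_def cis_conv_exp mult_ac)

lemma digit_character_fls: "digit_character CARD('p) (fls_X :: 'p::prime_card mod_ring fls) laurent_char"
proof (rule digit_character.intro[OF digit_field_fls], unfold_locales)
  fix x y :: "'p mod_ring fls"
  let ?p = "CARD('p)" and ?t = "\<lambda>x :: 'p mod_ring fls. to_int_mod_ring (fls_nth x (- 1))"
  have p: "1 < ?p" using prime_gt_1_nat[OF prime_card[where 'a='p]] .
  show "laurent_char (x + y) = laurent_char x * laurent_char y"
  proof -
    \<comment> \<open>The carry: integer representatives add only modulo \<open>p\<close>. After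
      division by \<open>p\<close> it becomes an integer and disappears in
      \<open>cis\<close>.\<close>
    define k where "k = (?t x + ?t y) div int ?p"
    have "?t (x + y) = ?t x + ?t y - int ?p * k"
      by (simp add: to_int_mod_ring_add minus_mult_div_eq_mod k_def)
    then have "real_of_int (?t (x + y)) = of_int (?t x) + of_int (?t y) - real ?p * of_int k"
      by (simp only: of_int_add of_int_diff of_int_mult of_int_of_nat_eq)
    then have "of_int (?t (x + y)) / real ?p = (of_int (?t x) / real ?p + of_int (?t y) / real ?p) - of_int k"
      using p by (simp only: diff_divide_distrib add_divide_distrib) simp
    then have "cis (2 * pi * (of_int (?t (x + y)) / real ?p)) = cis (2 * pi * (of_int (?t x) / real ?p + of_int (?t y) / real ?p))"
      by (intro cis_2pi_cong) simp
    then show ?thesis by (simp add: laurent_char_cis cis_mult distrib_left)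
  qed
  show "cmod (laurent_char x) = 1" by (simp add: laurent_char_cis)
  show "laurent_char x = 1" if "x \<in> integers"
    using that by (simp add: laurent_char_cis fls_integers_iff)
  show "laurent_char (inverse (fls_X :: 'p mod_ring fls)) \<noteq> 1"
    using cis_2pi_over_neq_1[OF p] by (simp add: laurent_char_cis fls_inverse_X)
qed

section \<open>Two-sided digit expansions\<close>

context digit_field
begin

text \<open>This is the condition inside \<open>padic_digits\<close> with a general uniformizer, so
  uniqueness proved here settles that definite description.\<close>

definition digits_of :: "'k \<Rightarrow> (int \<Rightarrow> nat) \<Rightarrow> int \<Rightarrow> bool" where
  "digits_of x d r \<longleftrightarrow> (\<forall>k<r. d k = 0) \<and>
    (\<lambda>i. of_nat (d (r + int i)) * w powi (r + int i)) sums x"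

text \<open>Multiplication by \<open>w powi (- r)\<close> scales all distances by one nonzero
  constant, so convergence reduces to one-sided digit sums, where it amounts to a congruence at
  every level.\<close>

lemma digits_of_iff:
  "digits_of x d r \<longleftrightarrow> (\<forall>k<r. d k = 0) \<and>
    (\<forall>n. N (w powi (- r) * x - digit_sum (\<lambda>i. d (r + int i)) n) \<le> N w ^ n)"
proof -
  let ?a = "\<lambda>i. d (r + int i)"
  have scale: "(\<Sum>i<n. of_nat (?a i) * w powi (r + int i)) = w powi r * digit_sum ?a n" for n
    using N_w by (simp add: digit_sum_def sum_distrib_left power_int_add mult_ac)
  have x: "x = w powi r * (w powi (- r) * x)"
    using N_w by (simp add: power_int_minus)
  have dist: "dist (\<Sum>i<n. of_nat (?a i) * w powi (r + int i)) x
      = N w powi r * dist (digit_sum ?a n) (w powi (- r) * x)" for n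
    unfolding dist_eq_N scale by (subst x, simp only: N_mult N_powi flip: right_diff_distrib)
  have pos: "N w powi r \<noteq> 0" using N_w by simp
  let ?z = "w powi (- r) * x"
  have "(\<lambda>i. of_nat (?a i) * w powi (r + int i)) sums x \<longleftrightarrow>
      (\<lambda>n. dist (\<Sum>i<n. of_nat (?a i) * w powi (r + int i)) x) \<longlonglongrightarrow> 0"
    by (simp only: sums_def tendsto_dist_iff[of _ x])
  also have "\<dots> \<longleftrightarrow> (\<lambda>n. N w powi r * dist (digit_sum ?a n) ?z) \<longlonglongrightarrow> N w powi r * 0"
    by (simp only: dist mult_zero_right)
  also have "\<dots> \<longleftrightarrow> (\<lambda>n. dist (digit_sum ?a n) ?z) \<longlonglongrightarrow> 0"
    by (rule tendsto_mult_left_iff[OF pos])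
  also have "\<dots> \<longleftrightarrow> (\<lambda>i. of_nat (?a i) * w ^ i) sums ?z"
    by (simp only: sums_def digit_sum_def tendsto_dist_iff[of _ ?z])
  also have "\<dots> \<longleftrightarrow> (\<forall>n. N (?z - digit_sum ?a n) \<le> N w ^ n)"
    by (rule iffI, rule allI, erule digit_series_tail, rule sums_digit_sumI, erule spec)
  finally show ?thesis
    unfolding digits_of_def by (simp only:)
qed

text \<open>Prepending zero digits multiplies the scaled element and its digit sums by
  \<open>w ^ j\<close>. It brings expansions with different starting exponents to a common
  one.\<close>

lemma digits_of_shift:
  assumes d: "digits_of x d r" and r0: "r0 \<le> r"
  shows "digits_of x d r0"
proof -
  define j where "j = nat (r - r0)"
  have r: "r = r0 + int j" using r0 by (simp add: j_def)
  let ?z = "w powi (- r) * x" and ?a = "\<lambda>i. d (r + int i)" and ?b = "\<lambda>i. d (r0 + int i)"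
  have zero: "\<forall>k<r. d k = 0" and tail: "\<And>m. N (?z - digit_sum ?a m) \<le> N w ^ m"
    using d by (auto simp: digits_of_iff)
  have z: "w powi (- r0) * x = w ^ j * ?z"
    using N_w power_int_add[of w "int j" "- r"] by (simp add: r)
  have b0: "?b i = 0" if "i < j" for i using zero that by (simp add: r)
  have small: "digit_sum ?b n = 0" if "n \<le> j" for n
    using b0 that by (simp add: digit_sum_def)
  have large: "digit_sum ?b (j + m) = w ^ j * digit_sum ?a m" for m
  proof (induction m)
    case (Suc m)
    then show ?case
      by (simp add: digit_sum_def r power_add algebra_simps)
  qed (simp add: small, simp add: digit_sum_def)
  have "N (w ^ j * ?z - digit_sum ?b n) \<le> N w ^ n" for n
  proof (cases "n \<le> j")
    case True
    have "N ?z \<le> 1" using tail[of 0] by (simp add: digit_sum_def)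
    then have "N (w ^ j * ?z) \<le> N w ^ j * 1"
      unfolding N_mult[of "w ^ j"] N_power by (rule mult_left_mono) simp
    also have "\<dots> \<le> N w ^ n"
      using True N_w by (simp add: power_decreasing)
    finally show ?thesis using small[OF True] by simp
  next
    case False
    then obtain m where n: "n = j + m" using le_Suc_ex[of j n] by auto
    have "N (w ^ j * ?z - w ^ j * digit_sum ?a m) = N w ^ j * N (?z - digit_sum ?a m)"
      by (simp only: N_mult N_power flip: right_diff_distrib)
    also have "\<dots> \<le> N w ^ j * N w ^ m"
      using tail N_w by (intro mult_left_mono) auto
    finally show ?thesis unfolding n large by (simp add: power_add)
  qed
  moreover have "\<forall>k<r0. d k = 0" using zero r0 by simp
  ultimately show ?thesis unfolding digits_of_iff z by blast
qed

lemma digits_of_unique: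
  assumes "digits_of x d r" "digits_of x d' r'" "\<And>k. d k < p" "\<And>k. d' k < p"
  shows "d = d'"
proof
  fix k
  \<comment> \<open>A start below both expansions and not above \<open>k\<close>, so that position
    \<open>k\<close> is reached by the common digit sums.\<close>
  define r0 where "r0 = min k (min r r')"
  have d: "digits_of x d r0" "digits_of x d' r0"
    using digits_of_shift[OF assms(1), of r0] digits_of_shift[OF assms(2), of r0]
    by (simp_all add: r0_def)
  define i where "i = nat (k - r0)"
  have k: "k = r0 + int i" by (simp add: i_def r0_def)
  have "N (digit_sum (\<lambda>i. d (r0 + int i)) (Suc i) - digit_sum (\<lambda>i. d' (r0 + int i)) (Suc i)) \<le> N w ^ Suc i"
  proof (rule N_triangle_le)
    show "N (digit_sum (\<lambda>i. d (r0 + int i)) (Suc i) - w powi (- r0) * x) \<le> N w ^ Suc i"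
      using d(1) by (subst N_minus_commute) (simp add: digits_of_iff del: power_Suc)
    show "N (w powi (- r0) * x - digit_sum (\<lambda>i. d' (r0 + int i)) (Suc i)) \<le> N w ^ Suc i"
      using d(2) by (simp add: digits_of_iff del: power_Suc)
  qed
  then show "d k = d' k"
    unfolding k using assms(3,4) by (intro digit_sum_unique[of "Suc i"]) auto
qed

text \<open>A high power of \<open>w\<close> moves \<open>x\<close> into the integers. Starting at
  \<open>- int m\<close>, never above 0, leaves exactly \<open>m\<close> places for the fractional
  part.\<close>

lemma digits_of_exists:
  obtains d m where "\<And>k. d k < p" "digits_of x d (- int m)"
proof -
  obtain m where m: "w ^ m * x \<in> integers"
  proof (cases "x = 0")
    case False
    then have pos: "0 < N x" using N_ge_0[of x] N_eq_0[of x] by linarith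
    then have "\<forall>\<^sub>F m in sequentially. N w ^ m < 1 / N x"
      by (intro order_tendstoD(2)[OF N_w_power_tendsto_0]) simp
    then obtain m where "N w ^ m < 1 / N x"
      by (auto simp: eventually_sequentially)
    then have "N (w ^ m * x) \<le> 1"
      using pos by (simp add: N_mult pos_less_divide_eq)
    then show ?thesis using that by (simp add: mem_integers)
  qed (use that[of 0] integers_0 in simp)
  obtain a where a: "\<And>i. a i < p" "\<And>n. N (w ^ m * x - digit_sum a n) \<le> N w ^ n"
    using digit_sum_exists[OF m] by blast
  define d where "d k = (if k < - int m then 0 else a (nat (k + int m)))" for k
  have "digits_of x d (- int m)"
    using a(2) by (simp add: digits_of_iff d_def)
  moreover have "d k < p" for k using a(1) p_gt_1 by (simp add: d_def)
  ultimately show ?thesis by (rule that[rotated])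
qed

end

section \<open>The field of \<open>p\<close>-adic numbers\<close>

lemma prime_CARD: "prime (int CARD('p::prime_card))" "1 < CARD('p)"
  using prime_card[where 'a='p] prime_gt_1_nat by auto

lemma padic_residue_of_nat: "padic_residue (of_nat k :: 'p::prime_card padic_int) n = int k mod int CARD('p) ^ n"
proof (induction k)
  case (Suc k)
  have "padic_residue (1 :: 'p padic_int) n = 1 mod int CARD('p) ^ n"
    by transfer simp
  with Suc show ?case by (simp add: padic_residue_add mod_simps)
qed simp

lemma padic_residue_diff:
  fixes x y :: "'p::prime_card padic_int"
  shows "padic_residue (x - y) n = (padic_residue x n - padic_residue y n) mod int CARD('p) ^ n"
  by transfer simp

lemma padic_residue_of_int: "padic_residue (of_int k :: 'p::prime_card padic_int) n = k mod int CARD('p) ^ n"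
  by (cases k rule: int_diff_cases) (simp add: padic_residue_diff padic_residue_of_nat mod_simps)

text \<open>Both sides say that the valuation is at least \<open>n\<close>. The ultrametric
  inequality and the digit conditions thereby become statements about residues.\<close>

lemma absval_padic_le_iff:
  fixes x :: "'p::prime_card padic_int"
  shows "absval x \<le> 1 / real CARD('p) ^ n \<longleftrightarrow> padic_residue x n = 0"
proof (cases "x = 0")
  case False
  have "absval x \<le> 1 / real CARD('p) ^ n \<longleftrightarrow> real CARD('p) ^ n \<le> real CARD('p) ^ padic_val x"
    using False by (simp add: absval_padic_int_def divide_le_eq le_divide_eq)
  also have "\<dots> \<longleftrightarrow> n \<le> padic_val x"
    using prime_CARD(2)[where 'p='p] by simp
  finally show ?thesis using False by (simp add: padic_val_residue_iff)
qed (simp add: absval_padic_int_def)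

lemma absval_padic_cases:
  fixes x :: "'p::prime_card padic_int"
  obtains "x = 0" | n where "absval x = 1 / real CARD('p) ^ n" "padic_residue x n = 0" "x \<noteq> 0"
  using absval_padic_le_iff[of x "padic_val x"] by (cases "x = 0") (auto simp: absval_padic_int_def)

lemma absval_padic_geI:
  fixes x :: "'p::prime_card padic_int"
  assumes "padic_residue x (Suc n) \<noteq> 0"
  shows "1 / real CARD('p) ^ n \<le> absval x"
proof (cases x rule: absval_padic_cases)
  case (2 k)
  have "k \<le> n"
  proof (rule ccontr)
    assume "\<not> k \<le> n"
    then have "padic_residue x (Suc n) = 0"
      using padic_residue_mod[of "Suc n" k x] 2 by simp
    with assms show False by simp
  qed
  then have "real CARD('p) ^ k \<le> real CARD('p) ^ n"
    by (intro power_increasing) (simp_all add: Suc_le_eq)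
  then show ?thesis unfolding 2 by (intro divide_left_mono) simp_all
qed (use assms in simp)

lemma absval_padic_ultra:
  fixes x y :: "'p::prime_card padic_int"
  shows "absval (x + y) \<le> max (absval x) (absval y)"
proof -
  have *: "absval (u + v) \<le> absval v" if "absval u \<le> absval v" for u v :: "'p padic_int"
  proof (cases v rule: absval_padic_cases)
    case 1
    with that absval_nonneg[of u] show ?thesis by (simp add: order.antisym)
  next
    case (2 n)
    then have "padic_residue u n = 0" using that absval_padic_le_iff[of u n] by simp
    with 2 have "padic_residue (u + v) n = 0" by (simp add: padic_residue_add)
    with 2 show ?thesis using absval_padic_le_iff[of "u + v" n] by simp
  qed
  show ?thesis
    using *[of x y] *[of y x] by (cases "absval x \<le> absval y") (auto simp: add.commute)
qed

lemma absval_padic_of_nat_CARD: "absval (of_nat CARD('p) :: 'p::prime_card padic_int) = 1 / real CARD('p)"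
proof (rule antisym)
  let ?w = "of_nat CARD('p) :: 'p padic_int"
  show "absval ?w \<le> 1 / real CARD('p)"
    using absval_padic_le_iff[of ?w 1] by (simp add: padic_residue_of_nat)
  have "padic_residue ?w (Suc 1) \<noteq> 0"
    using prime_CARD(2)[where 'p='p] unfolding padic_residue_of_nat by simp
  then show "1 / real CARD('p) \<le> absval ?w"
    using absval_padic_geI[of ?w 1] by simp
qed

lemma absval_padic_of_nat_unit:
  assumes "0 < d" "d < CARD('p::prime_card)"
  shows "absval (of_nat d :: 'p padic_int) = 1"
proof (rule antisym)
  show "absval (of_nat d :: 'p padic_int) \<le> 1"
    using absval_padic_le_iff[of "of_nat d :: 'p padic_int" 0] by simp
  have "padic_residue (of_nat d :: 'p padic_int) (Suc 0) \<noteq> 0"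
    using assms unfolding padic_residue_of_nat by simp
  then show "1 \<le> absval (of_nat d :: 'p padic_int)"
    using absval_padic_geI[of "of_nat d :: 'p padic_int" 0] by simp
qed

section \<open>Extension to the fraction field\<close>

lemma absval_fract_mult: "absval_fract (x * y) = absval_fract x * absval_fract y"
  by (cases x; cases y) (simp add: absval_fract_Fract absval_mult)

lemma absval_fract_embed: "absval_fract (Fract a 1) = absval a"
proof -
  have "absval (1::'a) * absval (1::'a) = absval (1::'a) * 1" using absval_mult[of "1::'a" 1] by simp
  then have "absval (1::'a) = 1" unfolding mult_cancel_left by simp
  then show ?thesis by (simp add: absval_fract_Fract)
qed

lemma absval_fract_ultra: "absval_fract (x + y) \<le> max (absval_fract x) (absval_fract (y :: 'p::prime_card padic))"
proof (cases x, cases y)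
  fix a b c d :: "'p padic_int"
  assume xy: "x = Fract a b" "b \<noteq> 0" "y = Fract c d" "d \<noteq> 0"
  then have pos: "0 < absval b" "0 < absval d"
    using absval_nonneg by (simp_all add: less_le eq_commute[of 0])
  have "absval_fract (x + y) = absval (a * d + c * b) / (absval b * absval d)"
    using xy by (simp add: absval_fract_Fract absval_mult)
  also have "\<dots> \<le> max (absval a * absval d) (absval c * absval b) / (absval b * absval d)"
    using absval_padic_ultra[of "a * d" "c * b"] pos
    by (intro divide_right_mono) (simp_all add: absval_mult)
  also have "\<dots> = max (absval_fract x) (absval_fract y)"
    using xy pos by (simp add: absval_fract_Fract max_divide_distrib_right)
  finally show ?thesis .
qed

lemma digit_field_padic: "digit_field CARD('p) (of_nat CARD('p) :: 'p::prime_card padic)"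
proof
  let ?p = "CARD('p)" and ?w = "of_nat CARD('p) :: 'p padic"
  fix x y :: "'p padic"
  have p: "1 < real ?p" using prime_CARD(2)[where 'p='p] by simp
  have dist0: "dist x 0 = absval_fract x" for x :: "'p padic" by (simp add: dist_fract_def)
  show "1 < ?p" by (rule prime_CARD)
  show "dist x y = dist (x - y) 0" by (simp add: dist_fract_def)
  show "dist (x * y) 0 = dist x 0 * dist y 0" by (simp add: dist0 absval_fract_mult)
  show "dist (x + y) 0 \<le> max (dist x 0) (dist y 0)" by (simp add: dist0 absval_fract_ultra)
  have w: "dist ?w 0 = 1 / real ?p"
    unfolding dist0 of_nat_fract absval_fract_embed absval_padic_of_nat_CARD ..
  then show "0 < dist ?w 0" "dist ?w 0 < 1" using p by simp_all
  show "dist (of_nat d) (0 :: 'p padic) = 1" if "0 < d" "d < ?p" for d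
    unfolding dist0 of_nat_fract absval_fract_embed using that by (rule absval_padic_of_nat_unit)
  obtain a b where x: "x = Fract a b" "b \<noteq> 0" by (cases x) auto
  obtain v where v: "absval b = 1 / real ?p ^ v" "padic_residue b v = 0"
    using x(2) by (cases b rule: absval_padic_cases) auto
  \<comment> \<open>Division by \<open>b\<close>, of valuation \<open>v\<close>, shifts the
    condition on the numerator by \<open>v\<close> places.\<close>
  have le_iff: "dist x 0 \<le> 1 / real ?p ^ k \<longleftrightarrow> padic_residue a (k + v) = 0" for k
    using p unfolding absval_padic_le_iff[symmetric]
    by (simp add: x dist0 absval_fract_Fract v power_add field_simps)
  show "dist x 0 \<le> dist ?w 0" if "dist x 0 < 1"
  proof (cases a rule: absval_padic_cases)
    case (2 n)
    have "real ?p ^ v < real ?p ^ n"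
      using that p unfolding x dist0 absval_fract_Fract[OF x(2)] v 2 by (simp add: divide_less_eq)
    then have "Suc v \<le> n" using p by (simp add: Suc_le_eq)
    then have "padic_residue a (1 + v) = 0" using padic_residue_mod[of "Suc v" n a] 2 by simp
    then show ?thesis using le_iff[of 1] by (simp add: w)
  next
    case 1
    then have "dist x 0 = 0" using x by (simp add: fract_collapse)
    then show ?thesis by (simp add: w)
  qed
  show "\<exists>d<?p. dist (x - of_nat d) 0 < 1" if "dist x 0 \<le> 1"
  proof -
    have "padic_residue a v = 0" using that le_iff[of 0] by simp
    \<comment> \<open>After removing \<open>p ^ v\<close>, numerator and denominator are
      \<open>\<alpha>\<close> and \<open>\<beta>\<close> modulo \<open>p\<close>. As
      \<open>b\<close> has valuation exactly \<open>v\<close>, \<open>\<beta>\<close> is invertible,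
      and the digit sought is the quotient modulo \<open>p\<close>.\<close>
    then obtain \<alpha> \<beta> where ab: "padic_residue a (Suc v) = int ?p ^ v * \<alpha>" "padic_residue b (Suc v) = int ?p ^ v * \<beta>"
      using v(2) padic_residue_dvd_iff[of v "Suc v" a] padic_residue_dvd_iff[of v "Suc v" b]
      by (auto elim!: dvdE)
    have "\<not> int ?p dvd \<beta>"
    proof
      assume "int ?p dvd \<beta>"
      then have "int ?p ^ Suc v dvd padic_residue b (Suc v)"
        unfolding ab power_Suc2 by (rule mult_dvd_mono[OF dvd_refl])
      then have "padic_residue b (Suc v) = 0"
        by (simp add: padic_residue_dvd_iff del: power_Suc)
      then have "absval b \<le> 1 / real ?p ^ Suc v" by (simp only: absval_padic_le_iff)
      then show False using v p by (simp add: field_simps)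
    qed
    then have "coprime \<beta> (int ?p)"
      using prime_CARD(1)[where 'p='p] by (metis coprime_commute prime_imp_coprime)
    then obtain u where u: "[\<beta> * u = 1] (mod int ?p)" using cong_solve_coprime_int by blast
    define d where "d = nat (\<alpha> * u mod int ?p)"
    have d: "int d = \<alpha> * u mod int ?p" by (simp add: d_def)
    have "[int d * \<beta> = \<alpha> * (\<beta> * u)] (mod int ?p)" by (simp add: d cong_def mod_simps mult_ac)
    also have "[\<alpha> * (\<beta> * u) = \<alpha> * 1] (mod int ?p)" by (intro cong_mult cong_refl u)
    finally have "int ?p dvd \<alpha> - int d * \<beta>" by (simp add: cong_iff_dvd_diff dvd_diff_commute)
    then have dv: "int ?p ^ Suc v dvd int ?p ^ v * (\<alpha> - int d * \<beta>)"
      unfolding power_Suc2 by (rule mult_dvd_mono[OF dvd_refl])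
    have "padic_residue (a - of_nat d * b) (Suc v) = (int ?p ^ v * (\<alpha> - int d * \<beta>)) mod int ?p ^ Suc v"
      by (simp only: padic_residue_diff padic_residue_mult padic_residue_of_nat ab mod_diff_right_eq mod_mult_left_eq)
        (simp add: algebra_simps)
    also have "\<dots> = 0" using dv by (rule dvd_imp_mod_0)
    finally have "absval (a - of_nat d * b) \<le> 1 / real ?p ^ Suc v" by (simp only: absval_padic_le_iff)
    also have "\<dots> < 1 / real ?p ^ v" using p by (simp add: field_simps)
    finally have "absval (a - of_nat d * b) < absval b" by (simp only: v)
    moreover have "x - of_nat d = Fract (a - of_nat d * b) b" using x by (simp add: of_nat_fract)
    moreover have "0 < absval b" using v(1) p by simp
    ultimately have "dist (x - of_nat d) 0 < 1"
      using x(2) by (simp add: dist0 absval_fract_Fract divide_less_eq)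
    moreover have "d < ?p" using d by (metis pos_mod_bound of_nat_less_iff of_nat_0_less_iff zero_less_card_finite)
    ultimately show ?thesis by blast
  qed
  show "\<exists>s. (\<lambda>i. of_nat (c i) * ?w ^ i) sums s" if c: "\<And>i. c i < ?p" for c :: "nat \<Rightarrow> nat"
  proof
    \<comment> \<open>Being less than \<open>p ^ n\<close> and compatible modulo powers of
      \<open>p\<close>, these partial sums are already the residues of a p-adic integer, which is
      the limit.\<close>
    define D where "D n = (\<Sum>i<n. c i * ?p ^ i)" for n
    have D_less: "D n < ?p ^ n" for n
    proof (induction n)
      case (Suc n)
      have "D (Suc n) < ?p ^ n + c n * ?p ^ n" using Suc by (simp add: D_def)
      also have "\<dots> = Suc (c n) * ?p ^ n" by simp
      also have "\<dots> \<le> ?p * ?p ^ n" using c[of n] by (intro mult_right_mono) auto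
      finally show ?case by simp
    qed (simp add: D_def)
    define s where "s = (Abs_padic_int (\<lambda>n. int (D n)) :: 'p padic_int)"
    have res: "padic_residue s n = int (D n)" for n
    proof -
      have "int (D n) \<in> {0..<int ?p ^ n} \<and> int (D (Suc n)) mod int ?p ^ n = int (D n)" for n
      proof -
        have less: "int (D n) < int ?p ^ n" using D_less[of n] by (metis of_nat_less_iff of_nat_power)
        have "int (D (Suc n)) = int (D n) + int (c n) * int ?p ^ n" by (simp add: D_def)
        also have "\<dots> mod int ?p ^ n = int (D n)" using less by (simp only: mod_mult_self1) simp
        finally have "int (D (Suc n)) mod int ?p ^ n = int (D n)" .
        with less show ?thesis by simp
      qed
      then show ?thesis unfolding s_def by (subst Abs_padic_int_inverse) auto
    qed
    have part: "(\<Sum>i<n. of_nat (c i) * ?w ^ i) = Fract (of_nat (D n)) 1" for n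
    proof -
      have "(\<Sum>i<n. of_nat (c i) * ?w ^ i) = of_nat (D n)" by (simp add: D_def)
      also have "\<dots> = Fract (of_nat (D n)) 1" by (rule of_nat_fract)
      finally show ?thesis .
    qed
    have "dist (\<Sum>i<n. of_nat (c i) * ?w ^ i) (Fract s 1) \<le> (1 / real ?p) ^ n" for n
    proof -
      have "dist (\<Sum>i<n. of_nat (c i) * ?w ^ i) (Fract s 1) = absval (of_nat (D n) - s)"
        unfolding part dist_fract_def by (simp add: absval_fract_embed)
      also have "\<dots> \<le> 1 / real ?p ^ n"
        unfolding absval_padic_le_iff padic_residue_diff padic_residue_of_nat res
        by (simp add: mod_simps)
      finally show ?thesis by (simp add: power_one_over)
    qed
    moreover have lim: "(\<lambda>n. (1 / real ?p) ^ n) \<longlonglongrightarrow> 0"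
      using p by (intro LIMSEQ_power_zero) simp
    ultimately have "(\<lambda>n. dist (\<Sum>i<n. of_nat (c i) * ?w ^ i) (Fract s 1)) \<longlonglongrightarrow> 0"
      by (intro tendsto_sandwich[OF _ _ tendsto_const lim]) auto
    then show "(\<lambda>i. of_nat (c i) * ?w ^ i) sums Fract s 1"
      unfolding sums_def by (rule tendsto_dist_iff[THEN iffD2])
  qed
qed

interpretation padic: digit_field "CARD('p)" "of_nat CARD('p) :: 'p::prime_card padic"
  by (rule digit_field_padic)

section \<open>Fractional parts and the standard p-adic character\<close>

text \<open>In other words, an element of Z[1/p] that is a p-adic integer lies in Z. This makes the
  character independent of the fraction chosen for \<open>x\<close>.\<close>

lemma padic_of_int_div_integers:
  assumes "of_int k / of_nat CARD('p) ^ n \<in> (integers :: 'p::prime_card padic set)"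
  shows "int CARD('p) ^ n dvd k"
proof -
  let ?w = "of_nat CARD('p) :: 'p padic"
  have "(of_int k :: 'p padic) = Fract (of_int k) 1"
    by (cases k rule: int_diff_cases) (simp add: of_nat_fract)
  then have k: "padic.N (of_int k :: 'p padic) = absval (of_int k :: 'p padic_int)"
    by (simp add: padic.N_def dist_fract_def absval_fract_embed)
  have w: "padic.N ?w = 1 / real CARD('p)"
    by (simp only: padic.N_def dist_fract_def diff_zero of_nat_fract absval_fract_embed absval_padic_of_nat_CARD)
  have "padic.N (of_int k / ?w ^ n) \<le> 1"
    using assms by (simp only: padic.mem_integers)
  then have "absval (of_int k :: 'p padic_int) \<le> 1 / real CARD('p) ^ n"
    using prime_CARD(2)[where 'p='p]
    by (simp only: padic.N_divide padic.N_power k w) (simp add: power_one_over field_simps)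
  then show ?thesis
    by (simp only: absval_padic_le_iff padic_residue_of_int dvd_eq_mod_eq_0)
qed

lemma padic_digits_eq:
  assumes "\<And>k. d k < CARD('p::prime_card)" "padic.digits_of (x :: 'p padic) d r"
  shows "padic_digits x = d"
  unfolding padic_digits_def padic.digits_of_def[symmetric]
proof (rule the_equality)
  show "(\<forall>k. d k < CARD('p)) \<and> (\<exists>r. padic.digits_of x d r)"
    using assms by blast
  fix d' assume "(\<forall>k. d' k < CARD('p)) \<and> (\<exists>r. padic.digits_of x d' r)"
  then obtain r' where r': "\<And>k. d' k < CARD('p)" "padic.digits_of x d' r'" by blast
  show "d' = d"
    by (rule padic.digits_of_unique[OF r'(2) assms(2) r'(1) assms(1)])
qed

lemma padic_frac_exists:
  fixes x :: "'p::prime_card padic"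
  obtains D m where "x - of_nat D / of_nat CARD('p) ^ m \<in> integers"
    "padic_frac x = real D / real CARD('p) ^ m"
proof -
  let ?p = "CARD('p)" and ?w = "of_nat CARD('p) :: 'p padic"
  obtain d m where d: "\<And>k. d k < ?p" "padic.digits_of x d (- int m)"
    using padic.digits_of_exists[of x] by blast
  \<comment> \<open>The \<open>m\<close> digits at negative positions, read as one natural
    number.\<close>
  define D where "D = (\<Sum>i<m. d (- int m + int i) * ?p ^ i)"
  have dx: "padic_digits x = d" by (rule padic_digits_eq[OF d])
  have p: "real ?p \<noteq> 0" by simp
  have w: "?w \<noteq> 0" using padic.N_w(3)[where 'p='p] .
  \<comment> \<open>The sum in \<open>padic_frac\<close> runs over nonzero digits only; zero terms
    are added to reach the full range of negative positions.\<close>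
  have "padic_frac x = (\<Sum>k\<in>{- int m..<0}. real (d k) * real ?p powi k)"
    unfolding padic_frac_def dx using d(2)
    by (intro sum.mono_neutral_left) (auto simp: padic.digits_of_def not_less[symmetric])
  also have "\<dots> = (\<Sum>i<m. real (d (- int m + int i)) * real ?p powi (- int m + int i))"
    by (rule sum.reindex_bij_witness[where i="\<lambda>i. - int m + int i" and j="\<lambda>k. nat (k + int m)"]) auto
  also have "\<dots> = real D / real ?p ^ m"
    unfolding D_def of_nat_sum sum_divide_distrib
  proof (rule sum.cong[OF refl])
    fix i
    show "real (d (- int m + int i)) * real ?p powi (- int m + int i)
        = real (d (- int m + int i) * ?p ^ i) / real ?p ^ m"
      using power_int_add[of "real ?p" "- int m" "int i"] p
      by (simp add: power_int_minus divide_inverse)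
  qed
  finally have frac: "padic_frac x = real D / real ?p ^ m" .
  have "padic.digit_sum (\<lambda>i. d (- int m + int i)) m = (of_nat D :: 'p padic)"
    by (simp add: padic.digit_sum_def D_def)
  moreover have "padic.N (?w powi int m * x - padic.digit_sum (\<lambda>i. d (- int m + int i)) m) \<le> padic.N ?w ^ m"
    using d(2) unfolding padic.digits_of_iff by simp
  ultimately have "?w powi (- int m) * (?w powi int m * x - of_nat D) \<in> integers"
    by (simp only: padic.N_le_power_iff)
  also have "?w powi (- int m) * (?w powi int m * x - of_nat D) = x - of_nat D / ?w ^ m"
    using w by (simp add: power_int_minus right_diff_distrib divide_inverse mult_ac)
  finally show ?thesis using frac by (rule that)
qed

text \<open>Two fractions congruent to \<open>x\<close> modulo the p-adic integers differ by an
  element of Z, which \<open>cis\<close> does not see. As \<open>D\<close> is any integer,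
  numerators can be added without reducing to digits.\<close>

lemma padic_char_eq:
  fixes x :: "'p::prime_card padic"
  assumes D: "x - of_int D / of_nat CARD('p) ^ m \<in> integers"
  shows "padic_char x = cis (2 * pi * (of_int D / real CARD('p) ^ m))"
proof -
  let ?p = "CARD('p)" and ?w = "of_nat CARD('p) :: 'p padic"
  have p: "real ?p \<noteq> 0" by simp
  have w: "?w \<noteq> 0" using padic.N_w(3)[where 'p='p] .
  obtain E n where E: "x - of_nat E / ?w ^ n \<in> integers" "padic_frac x = real E / real ?p ^ n"
    by (rule padic_frac_exists)
  define k where "k = int E * int ?p ^ m - D * int ?p ^ n"
  have "of_int k / ?w ^ (m + n) = (x - of_int D / ?w ^ m) - (x - of_nat E / ?w ^ n)"
    using w by (simp add: k_def power_add diff_divide_distrib)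
  then have "of_int k / ?w ^ (m + n) \<in> (integers :: 'p padic set)"
    using padic.integers_diff[OF D E(1)] by simp
  then obtain j where j: "k = int ?p ^ (m + n) * j"
    using padic_of_int_div_integers by (blast elim: dvdE)
  have "real E / real ?p ^ n - of_int D / real ?p ^ m = of_int k / real ?p ^ (m + n)"
    using p by (simp add: k_def power_add diff_divide_distrib)
  also have "\<dots> = of_int j" using p by (simp add: j)
  finally have "cis (2 * pi * (real E / real ?p ^ n)) = cis (2 * pi * (of_int D / real ?p ^ m))"
    by (intro cis_2pi_cong) simp
  then show ?thesis
    by (simp add: padic_char_def E(2) cis_conv_exp mult_ac)
qed

lemma digit_character_padic: "digit_character CARD('p) (of_nat CARD('p)) (padic_char :: 'p::prime_card padic \<Rightarrow> complex)"
proof (rule digit_character.intro[OF digit_field_padic], unfold_locales)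
  fix x y :: "'p padic"
  let ?p = "CARD('p)" and ?w = "of_nat CARD('p) :: 'p padic"
  have p: "real ?p \<noteq> 0" by simp
  have w: "?w \<noteq> 0" using padic.N_w(3)[where 'p='p] .
  show "padic_char (x + y) = padic_char x * padic_char y"
  proof -
    obtain D m where D: "x - of_nat D / ?w ^ m \<in> integers" "padic_frac x = real D / real ?p ^ m"
      by (rule padic_frac_exists)
    obtain E n where E: "y - of_nat E / ?w ^ n \<in> integers" "padic_frac y = real E / real ?p ^ n"
      by (rule padic_frac_exists)
    \<comment> \<open>Numerator of the sum over the common denominator \<open>p ^ (m + n)\<close>;
      it may exceed the denominator, which \<open>padic_char_eq\<close> permits.\<close>
    let ?F = "int D * int ?p ^ n + int E * int ?p ^ m"
    have eq: "x + y - of_int ?F / ?w ^ (m + n) = (x - of_nat D / ?w ^ m) + (y - of_nat E / ?w ^ n)"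
      using w by (simp add: power_add add_divide_distrib)
    have "x + y - of_int ?F / ?w ^ (m + n) \<in> integers"
      unfolding eq by (rule padic.integers_add[OF D(1) E(1)])
    then have "padic_char (x + y) = cis (2 * pi * (of_int ?F / real ?p ^ (m + n)))"
      by (rule padic_char_eq)
    also have "of_int ?F / real ?p ^ (m + n) = real D / real ?p ^ m + real E / real ?p ^ n"
      using p by (simp add: power_add add_divide_distrib)
    also have "cis (2 * pi * \<dots>) = padic_char x * padic_char y"
      using padic_char_eq[of x "int D" m] padic_char_eq[of y "int E" n] D(1) E(1)
      by (simp add: distrib_left cis_mult)
    finally show ?thesis .
  qed
  show "cmod (padic_char x) = 1"
    by (simp add: padic_char_def norm_exp_eq_Re)
  show "padic_char x = 1" if "x \<in> integers"
    using padic_char_eq[of x 0 0] that by simp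
  show "padic_char (inverse ?w) \<noteq> 1"
    using padic_char_eq[of "inverse ?w" 1 1] cis_2pi_over_neq_1[OF prime_CARD(2)[where 'p='p]]
    by (simp add: inverse_eq_divide padic.integers_0)
qed

theorem theorem5:
  shows
    "((\<forall>\<mu> :: 'p::prime_card padic measure. normalized_haar \<mu> \<longrightarrow>
         orthonormal_basis (restrict_space \<mu> integers)
           (character_group CARD('p) (of_nat CARD('p)) padic_char)) \<and>
      orthonormal_basis (lebesgue_on {0..1})
        (omega_system CARD('p) (of_nat CARD('p)) (padic_char :: 'p padic \<Rightarrow> complex))) \<and>
     ((\<forall>\<mu> :: 'p mod_ring fls measure. normalized_haar \<mu> \<longrightarrow>
         orthonormal_basis (restrict_space \<mu> integers)
           (character_group CARD('p) fls_X laurent_char)) \<and>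
      orthonormal_basis (lebesgue_on {0..1})
        (omega_system CARD('p) fls_X (laurent_char :: 'p mod_ring fls \<Rightarrow> complex)))"
  using digit_character.orthonormal_basis_haar[OF digit_character_padic[where 'p='p]]
    digit_character.orthonormal_basis_omega[OF digit_character_padic[where 'p='p]]
    digit_character.orthonormal_basis_haar[OF digit_character_fls[where 'p='p]]
    digit_character.orthonormal_basis_omega[OF digit_character_fls[where 'p='p]]
  by blast

end
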